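(* Let $n\ge 2$ be an integer and let $p>0$. Let $f:\mathbb{R}_+\times\mathbb{R}_+\to\mathbb{R}_+$ be a continuous function satisfying the following condition: for any $x\in\mathbb{R}^n\setminus\{0\}$, any $0<\lambda<|x|$, any $z\in\mathbb{R}^n$ with $|z-x|>\lambda$, and any $a\le b$ in $\mathbb{R}_+$, $$f(|z|,a)>\Big(\frac{\lambda}{|z-x|}\Big)^{p+2n} f\Big(\Big|x+\frac{\lambda^2(z-x)}{|z-x|^2}\Big|,\ \Big(\frac{\lambda}{|z-x|}\Big)^{p} b\Big).$$ Then any positive function $u\in C^1(\mathbb{R}^n\setminus\{0\})$ satisfying $$u(x)=\int_{\mathbb{R}^n}|x-y|^p f(|y|,u(y))\,dy\qquad\text{for all }x\in\mathbb{R}^n\setminus\{0\}$$ is radially symmetric and monotone increasing with respect to the origin; that is, there is a monotone increasing function $g:(0,\infty)\to(0,\infty)$ with $u(x)=g(|x|)$ for all $x\in\mathbb{R}^n\setminus\{0\}$.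
   Context: $\mathbb{R}_+=(0,\infty)$; expressions $f(|z|,\cdot)$ are considered only for $z\ne0$. "Monotone increasing" means $g(t_1)\le g(t_2)$ whenever $0<t_1<t_2$. *)

theory Defs
  imports "HOL-Analysis.Analysis"
begin

text \<open>
  Continuous differentiability on an open set: the Frechet derivative exists at every point and
  depends continuously on the point in the operator norm.
\<close>

definition C1_on :: "('a::real_normed_vector \<Rightarrow> 'b::real_normed_vector) \<Rightarrow> 'a set \<Rightarrow> bool" where
  "C1_on u S \<longleftrightarrow> (\<exists>u' :: 'a \<Rightarrow> 'a \<Rightarrow>\<^sub>L 'b.
      (\<forall>x\<in>S. (u has_derivative blinfun_apply (u' x)) (at x)) \<and> continuous_on S u')"

end

theory Submission
  imports Defs
begin

text \<open>
  The proof is the method of moving spheres. Put \<open>F y = f \<bar>y\<bar> (u y)\<close>. Finiteness of the integral at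
  two antipodal points bounds both the mass of \<open>F\<close> and its moment of order \<open>p\<close>, so the potential
  \<open>U x = \<integral> \<bar>x - y\<bar>\<^sup>p F y dy\<close> is a continuous positive function on the whole space, the origin included,
  and it extends \<open>u\<close>. Write \<open>y\<^sup>*\<close> for the image of \<open>y\<close> under inversion in the sphere of centre \<open>x\<close> and
  radius \<open>l\<close>, and compare \<open>U\<close> with its Kelvin transform \<open>(\<bar>z - x\<bar> / l)\<^sup>p U(z\<^sup>*)\<close>.

  Folding the interior of the sphere onto its exterior by the change of variables \<open>y \<mapsto> y\<^sup>*\<close> gives
  (\<open>kelvin_minus_U\<close>) that the difference of Kelvin transform and \<open>U\<close> at a point \<open>z\<close> outside the
  sphere is the integral over the exterior of \<open>kernel_gap * gain\<close>. The first factor is positive by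
  geometry. The second is \<open>F y - (l / \<bar>y - x\<bar>)\<^sup>p\<^sup>+\<^sup>2\<^sup>n F(y\<^sup>*)\<close>, and the condition on \<open>f\<close> says that it is
  positive wherever \<open>U\<close> does not exceed its Kelvin transform. So the weak inequality on the whole exterior
  improves itself to a strict one, quantitatively at the sphere (\<open>admissible_hopf\<close>) and at infinity
  (\<open>admissible_mass\<close>).

  Call \<open>l\<close> admissible for \<open>x\<close> if \<open>U\<close> does not exceed its Kelvin transform outside the sphere. Within
  \<open>(0, \<bar>x\<bar>)\<close> the admissible radii form a set that is nonempty, since \<open>r\<^sup>-\<^sup>p\<^sup>/\<^sup>2 U(x + r \<theta>)\<close> decreases for
  small \<open>r\<close> (\<open>admissible_small\<close>); closed, by continuity (\<open>inadmissible_open\<close>); and open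
  (\<open>admissible_open\<close>): points violating the inequality for radii near \<open>l\<close> would accumulate at infinity,
  outside the sphere or on it, and the three strict statements exclude this. Hence every radius below
  \<open>\<bar>x\<bar>\<close> is admissible (\<open>admissible_all\<close>).

  Finally, if \<open>\<bar>y\<bar> < \<bar>y'\<bar>\<close>, then on the ray from \<open>y\<close> through \<open>y'\<close> each centre \<open>x\<close> beyond \<open>y'\<close> belongs to
  exactly one sphere whose inversion exchanges \<open>y\<close> and \<open>y'\<close>, and its radius is less than \<open>\<bar>x\<bar>\<close>. The resulting
  inequality tends to \<open>U y \<le> U y'\<close> as the centre recedes to infinity (\<open>U_mono_strict\<close>). By continuity
  the inequality persists for \<open>\<bar>y\<bar> = \<bar>y'\<bar>\<close>, which contains both radial symmetry and monotonicity.
\<close>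

section \<open>Renaming coordinates by a well-ordered index type\<close>

text \<open>
  The Jacobian formula applies to \<open>real ^ 'm\<close> with a well-ordered index type \<open>'m\<close>. Every finite type has
  a copy that is well-ordered by an enumeration, and renaming coordinates along the copy is a linear
  isometry that preserves Lebesgue measure; so the formula carries over to every finite index type.
\<close>

typedef 'a wo_copy = "UNIV :: 'a set" by auto

instance wo_copy :: (finite) finite
proof
  have "(UNIV :: 'a wo_copy set) = range Abs_wo_copy"
    by (metis Rep_wo_copy_inverse surjI)
  then show "finite (UNIV :: 'a wo_copy set)" by (metis finite finite_imageI)
qed

instantiation wo_copy :: (finite) wellorder
begin

definition less_eq_wo_copy :: "'a wo_copy \<Rightarrow> 'a wo_copy \<Rightarrow> bool" where
  "less_eq_wo_copy a b \<longleftrightarrow> to_nat (Rep_wo_copy a) \<le> to_nat (Rep_wo_copy b)"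

definition less_wo_copy :: "'a wo_copy \<Rightarrow> 'a wo_copy \<Rightarrow> bool" where
  "less_wo_copy a b \<longleftrightarrow> to_nat (Rep_wo_copy a) < to_nat (Rep_wo_copy b)"

instance
proof
  fix P :: "'a wo_copy \<Rightarrow> bool" and a
  assume step: "\<And>x. (\<And>y. y < x \<Longrightarrow> P y) \<Longrightarrow> P x"
  show "P a"
    by (induction "to_nat (Rep_wo_copy a)" arbitrary: a rule: less_induct)
      (metis step less_wo_copy_def)
qed (auto simp: less_eq_wo_copy_def less_wo_copy_def Rep_wo_copy_inject)

end

definition relabel :: "real ^ 'n \<Rightarrow> real ^ ('n::finite) wo_copy" where
  "relabel x = (\<chi> i. x $ Rep_wo_copy i)"

definition unlabel :: "real ^ ('n::finite) wo_copy \<Rightarrow> real ^ 'n" where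
  "unlabel y = (\<chi> i. y $ Abs_wo_copy i)"

lemma unlabel_relabel [simp]: "unlabel (relabel x) = x"
  by (simp add: relabel_def unlabel_def Abs_wo_copy_inverse)

lemma bij_Rep_wo_copy: "bij Rep_wo_copy"
  by (metis Abs_wo_copy_inverse Rep_wo_copy_inverse UNIV_I bij_iff)

lemma linear_relabel: "linear relabel"
  by (auto intro!: linearI simp: relabel_def vec_eq_iff)

lemma norm_relabel [simp]: "norm (relabel x) = norm x"
  by (simp add: norm_vec_def L2_set_def relabel_def
      sum.reindex_bij_betw[OF bij_Rep_wo_copy, where g = "\<lambda>i. (x $ i)\<^sup>2"])

lemma CARD_wo_copy: "CARD('n::finite wo_copy) = CARD('n)"
  using bij_Rep_wo_copy by (rule bij_betw_same_card)

lemma emeasure_lborel_box_cart: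
  fixes l u :: "real ^ 'n"
  assumes "\<And>i. l $ i \<le> u $ i"
  shows "emeasure lborel (box l u) = (\<Prod>i\<in>UNIV. u $ i - l $ i)"
proof -
  have B: "(Basis :: (real ^ 'n) set) = (\<lambda>i. axis i 1) ` UNIV"
    by (auto simp: Basis_vec_def)
  have inj: "inj (\<lambda>i::'n. axis i (1::real))"
    by (auto intro!: injI simp: axis_eq_axis)
  have "l \<bullet> b \<le> u \<bullet> b" if "b \<in> Basis" for b
    using that assms by (auto simp: B inner_axis)
  then have "emeasure lborel (box l u) = (\<Prod>b\<in>Basis. (u - l) \<bullet> b)"
    by (rule emeasure_lborel_box)
  then show ?thesis
    by (simp add: B prod.reindex[OF inj] inner_axis)
qed

lemma borel_measurable_relabel [measurable]: "relabel \<in> borel_measurable borel"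
  by (intro borel_measurable_continuous_onI linear_continuous_on)
    (use linear_relabel linear_conv_bounded_linear in blast)

text \<open>
  Renaming coordinates maps boxes to boxes with the same side lengths, and boxes determine
  Lebesgue measure.
\<close>

lemma lborel_relabel: "distr lborel borel (relabel :: real ^ 'n \<Rightarrow> _) = (lborel :: (real ^ 'n::finite wo_copy) measure)"
proof (rule lborel_eqI[symmetric])
  fix l u :: "real ^ 'n wo_copy"
  assume le: "\<And>b. b \<in> Basis \<Longrightarrow> l \<bullet> b \<le> u \<bullet> b"
  have le': "l $ i \<le> u $ i" for i
    using le[of "axis i 1"] by (auto simp: inner_axis Basis_vec_def)
  have "relabel -` box l u = box (unlabel l) (unlabel u)"
  proof (intro set_eqI)
    fix x :: "real ^ 'n"
    have "(\<forall>i. l $ i < x $ Rep_wo_copy i \<and> x $ Rep_wo_copy i < u $ i) \<longleftrightarrow>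
      (\<forall>j. l $ Abs_wo_copy j < x $ j \<and> x $ j < u $ Abs_wo_copy j)"
      by (metis Abs_wo_copy_inverse Rep_wo_copy_inverse UNIV_I)
    then show "x \<in> relabel -` box l u \<longleftrightarrow> x \<in> box (unlabel l) (unlabel u)"
      by (simp add: mem_box_cart relabel_def unlabel_def)
  qed
  then have "emeasure (distr lborel borel relabel) (box l u) = emeasure lborel (box (unlabel l) (unlabel u))"
    by (simp add: emeasure_distr)
  also have "\<dots> = (\<Prod>i\<in>UNIV. u $ i - l $ i)"
    using prod.reindex_bij_betw[OF bij_Rep_wo_copy, of "\<lambda>j. u $ Abs_wo_copy j - l $ Abs_wo_copy j"] le'
    by (simp add: emeasure_lborel_box_cart unlabel_def Rep_wo_copy_inverse)
  also have "\<dots> = emeasure lborel (box l u)"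
    using le' by (simp add: emeasure_lborel_box_cart)
  also have "\<dots> = (\<Prod>b\<in>Basis. (u - l) \<bullet> b)"
    using le by (rule emeasure_lborel_box)
  finally show "emeasure (distr lborel borel relabel) (box l u) = (\<Prod>b\<in>Basis. (u - l) \<bullet> b)" .
qed auto

section \<open>Inversion in a sphere\<close>

definition sphere_inversion :: "'a::real_inner \<Rightarrow> real \<Rightarrow> 'a \<Rightarrow> 'a" where
  "sphere_inversion x l z = x + (l\<^sup>2 / (norm (z - x))\<^sup>2) *\<^sub>R (z - x)"

lemma norm_sphere_inversion:
  "norm (sphere_inversion x l z - x) = l\<^sup>2 / norm (z - x)"
  by (simp add: sphere_inversion_def power2_eq_square)

lemma sphere_inversion_involution:
  assumes "z \<noteq> x" "l \<noteq> 0"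
  shows "sphere_inversion x l (sphere_inversion x l z) = z"
  unfolding sphere_inversion_def[of x l "sphere_inversion x l z"] norm_sphere_inversion
  using assms by (simp add: sphere_inversion_def field_simps)

text \<open>
  Up to a scalar, the derivative of an inversion is the reflection in the hyperplane orthogonal to the
  radius. That it is an isometry makes the Jacobian determinant immediate.
\<close>

lemma norm_householder:
  fixes w h :: "'a::real_inner"
  assumes "w \<noteq> 0"
  shows "norm (h - (2 * (w \<bullet> h) / (norm w)\<^sup>2) *\<^sub>R w) = norm h"
proof -
  have "w \<bullet> w \<noteq> 0" using assms by simp
  then have "(norm (h - (2 * (w \<bullet> h) / (norm w)\<^sup>2) *\<^sub>R w))\<^sup>2 = (norm h)\<^sup>2"
    unfolding power2_norm_eq_inner
    by (simp add: inner_diff inner_commute field_simps power2_eq_square)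
  then show ?thesis by simp
qed

lemma sphere_inversion_has_derivative:
  fixes x y :: "'a::real_inner"
  assumes "y \<noteq> x"
  shows "(sphere_inversion x l has_derivative
     (\<lambda>h. (l / norm (y - x))\<^sup>2 *\<^sub>R (h - (2 * ((y - x) \<bullet> h) / (norm (y - x))\<^sup>2) *\<^sub>R (y - x)))) (at y within S)"
proof -
  have eq: "sphere_inversion x l = (\<lambda>z. x + (l\<^sup>2 / ((z - x) \<bullet> (z - x))) *\<^sub>R (z - x))"
    by (auto simp: sphere_inversion_def power2_norm_eq_inner)
  have nz: "(y - x) \<bullet> (y - x) \<noteq> 0" using assms by simp
  define w where "w = y - x"
  have w: "w \<bullet> w \<noteq> 0" "y \<noteq> x" using nz by (auto simp: w_def)
  have "((\<lambda>z. x + (l\<^sup>2 / ((z - x) \<bullet> (z - x))) *\<^sub>R (z - x)) has_derivative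
      (\<lambda>h. (l\<^sup>2 / (w \<bullet> w)) *\<^sub>R h - (l\<^sup>2 * (2 * (w \<bullet> h)) / ((w \<bullet> w) * (w \<bullet> w))) *\<^sub>R w)) (at y within S)"
    by (rule has_derivative_eq_rhs, (auto intro!: derivative_eq_intros simp: nz w)[1])
      (simp add: w_def[symmetric] inner_commute)
  then show ?thesis
    unfolding eq power_divide power2_norm_eq_inner w_def[symmetric]
    by (simp add: scaleR_diff_right power2_eq_square mult_ac)
qed

lemma det_sphere_inversion_derivative:
  fixes w :: "real ^ 'n"
  assumes "w \<noteq> 0"
  shows "\<bar>det (matrix (\<lambda>h. c *\<^sub>R (h - (2 * (w \<bullet> h) / (norm w)\<^sup>2) *\<^sub>R w)))\<bar> = \<bar>c\<bar> ^ CARD('n)"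
proof -
  define R where "R = (\<lambda>h. h - (2 * (w \<bullet> h) / (norm w)\<^sup>2) *\<^sub>R w)"
  have lin: "linear R"
    by (auto intro!: linearI simp: R_def algebra_simps add_divide_distrib)
  have "orthogonal_transformation R"
    unfolding orthogonal_transformation using lin norm_householder[OF assms] by (auto simp: R_def)
  moreover have "matrix ((*\<^sub>R) c \<circ> R) = matrix ((*\<^sub>R) c) ** matrix R"
    using lin by (intro matrix_compose) auto
  moreover have "(*\<^sub>R) c \<circ> R = (\<lambda>h. c *\<^sub>R (h - (2 * (w \<bullet> h) / (norm w)\<^sup>2) *\<^sub>R w))"
    by (auto simp: R_def)
  ultimately show ?thesis
    by (metis (no_types, lifting) abs_mult det_matrix_scaleR det_mul mult.right_neutral
        orthogonal_transformation_det power_abs)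
qed

lemma inj_on_sphere_inversion:
  assumes "l \<noteq> 0" "x \<notin> S"
  shows "inj_on (sphere_inversion x l) S"
  using assms by (metis inj_onI sphere_inversion_involution)

lemma sphere_inversion_image_exterior:
  fixes x :: "'a::real_inner"
  assumes "l > 0"
  shows "sphere_inversion x l ` {y. l < norm (y - x)} = {y. norm (y - x) < l} - {x}"
proof (intro equalityI subsetI)
  fix z assume "z \<in> sphere_inversion x l ` {y. l < norm (y - x)}"
  then obtain y where y: "l < norm (y - x)" "z = sphere_inversion x l y" by auto
  then have "norm (z - x) = l\<^sup>2 / norm (y - x)" by (simp add: norm_sphere_inversion)
  moreover have "0 < l\<^sup>2 / norm (y - x)" "l\<^sup>2 / norm (y - x) < l"
    using y assms less_trans[OF assms y(1)]
    by (simp_all add: power2_eq_square pos_divide_less_eq)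
  ultimately show "z \<in> {y. norm (y - x) < l} - {x}" by auto
next
  fix z assume z: "z \<in> {y. norm (y - x) < l} - {x}"
  then have "0 < norm (z - x)" "norm (z - x) < l" by auto
  then have "l < norm (sphere_inversion x l z - x)"
    using assms by (auto simp: norm_sphere_inversion power2_eq_square field_simps)
  moreover have "z = sphere_inversion x l (sphere_inversion x l z)"
    using z assms by (simp add: sphere_inversion_involution)
  ultimately show "z \<in> sphere_inversion x l ` {y. l < norm (y - x)}" by blast
qed

lemma borel_measurable_sphere_inversion [measurable]:
  "(sphere_inversion x l :: 'a::euclidean_space \<Rightarrow> 'a) \<in> borel_measurable borel"
  unfolding sphere_inversion_def by measurable

text \<open>
  Inversion maps the exterior of the sphere onto the punctured ball, with Jacobian
  \<open>(l / \<bar>y - x\<bar>)\<^sup>2\<^sup>n\<close>; the puncture is a null set.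
\<close>

lemma inversion_integral_wellorder:
  fixes h :: "real ^ 'm::{finite,wellorder} \<Rightarrow> real"
  assumes l: "l > 0" and h: "integrable lborel h"
  shows "has_bochner_integral lborel
     (\<lambda>y. indicat_real {y. l < norm (y - x)} y * ((l / norm (y - x)) ^ (2 * CARD('m)) * h (sphere_inversion x l y)))
     (LINT y|lborel. indicat_real {y. norm (y - x) < l} y * h y)"
proof -
  let ?out = "{y. l < norm (y - x)}" and ?in = "{y. norm (y - x) < l}"
  let ?J = "\<lambda>y. (l / norm (y - x)) ^ (2 * CARD('m))"
  have [measurable]: "h \<in> borel_measurable borel" using h by auto
  have in_borel: "?in - {x} \<in> sets borel" "?in \<in> sets borel" "?out \<in> sets borel" by measurable
  have "(\<lambda>y. indicat_real (?in - {x}) y * h y) absolutely_integrable_on UNIV"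
    using integrable_mult_indicator[OF _ h, of "?in - {x}"] in_borel
    by (simp add: set_integrable_def integrable_completion)
  then have hin: "h absolutely_integrable_on (?in - {x})"
    unfolding set_integrable_def by simp
  let ?D = "\<lambda>y h. (l / norm (y - x))\<^sup>2 *\<^sub>R (h - (2 * ((y - x) \<bullet> h) / (norm (y - x))\<^sup>2) *\<^sub>R (y - x))"
  have J: "\<bar>det (matrix (?D y))\<bar> = ?J y" if "y \<in> ?out" for y
    using that l by (subst det_sphere_inversion_derivative) (auto simp: power_mult power_abs)
  define b where "b = integral (?in - {x}) h"
  \<comment> \<open>The Jacobian formula concerns vector valued functions, so h is read as a map into \<open>real ^ 1\<close>.\<close>
  have "(\<lambda>y. \<bar>det (matrix (?D y))\<bar> *\<^sub>R (vec (h (sphere_inversion x l y)) :: real^1)) absolutely_integrable_on ?out \<and>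
      integral ?out (\<lambda>y. \<bar>det (matrix (?D y))\<bar> *\<^sub>R (vec (h (sphere_inversion x l y)) :: real^1)) = vec b
    \<longleftrightarrow> (\<lambda>y. vec (h y) :: real^1) absolutely_integrable_on (sphere_inversion x l ` ?out) \<and>
      integral (sphere_inversion x l ` ?out) (\<lambda>y. vec (h y) :: real^1) = vec b"
    using in_borel(3) l
    by (intro has_absolute_integral_change_of_variables sphere_inversion_has_derivative inj_on_sphere_inversion)
      auto
  then have "(\<lambda>y. \<bar>det (matrix (?D y))\<bar> * h (sphere_inversion x l y)) absolutely_integrable_on ?out \<and>
      integral ?out (\<lambda>y. \<bar>det (matrix (?D y))\<bar> * h (sphere_inversion x l y)) = b"
    using hin
    by (simp add: sphere_inversion_image_exterior[OF l] absolutely_integrable_on_1_iff integral_on_1_eq b_def)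
  moreover have "(\<lambda>y. \<bar>det (matrix (?D y))\<bar> * h (sphere_inversion x l y)) absolutely_integrable_on ?out
      \<longleftrightarrow> (\<lambda>y. ?J y * h (sphere_inversion x l y)) absolutely_integrable_on ?out"
    by (rule set_integrable_cong) (use J in auto)
  moreover have "integral ?out (\<lambda>y. \<bar>det (matrix (?D y))\<bar> * h (sphere_inversion x l y))
      = integral ?out (\<lambda>y. ?J y * h (sphere_inversion x l y))"
    by (rule Henstock_Kurzweil_Integration.integral_cong) (use J in auto)
  ultimately have out: "(\<lambda>y. ?J y * h (sphere_inversion x l y)) absolutely_integrable_on ?out"
      "integral ?out (\<lambda>y. ?J y * h (sphere_inversion x l y)) = b"
    by simp_all
  have "integrable lebesgue (\<lambda>y. indicat_real ?out y * (?J y * h (sphere_inversion x l y)))"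
    using out(1) by (simp add: set_integrable_def)
  then have int: "integrable lborel (\<lambda>y. indicat_real ?out y * (?J y * h (sphere_inversion x l y)))"
    by (subst (asm) integrable_completion) auto
  have "(LINT y|lborel. indicat_real ?out y * (?J y * h (sphere_inversion x l y)))
     = (LINT y:?out|lebesgue. ?J y * h (sphere_inversion x l y))"
    unfolding set_lebesgue_integral_def by (subst integral_completion) auto
  also have "\<dots> = b"
    using out by (simp add: set_lebesgue_integral_eq_integral)
  also have "b = (LINT y:?in - {x}|lebesgue. h y)"
    unfolding b_def using hin by (simp add: set_lebesgue_integral_eq_integral)
  also have "\<dots> = (LINT y|lborel. indicat_real (?in - {x}) y * h y)"
    unfolding set_lebesgue_integral_def by (subst integral_completion) auto
  also have "\<dots> = (LINT y|lborel. indicat_real ?in y * h y)"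
  proof (rule integral_cong_AE)
    show "AE y in lborel. indicat_real (?in - {x}) y * h y = indicat_real ?in y * h y"
      using AE_lborel_singleton[of x] by eventually_elim (auto simp: indicator_def)
  qed auto
  finally show ?thesis
    using int by (simp add: has_bochner_integral_iff)
qed

lemma relabel_sphere_inversion:
  "relabel (sphere_inversion x l y) = sphere_inversion (relabel x) l (relabel y)"
proof -
  have "norm (relabel y - relabel x) = norm (y - x)"
    by (metis linear_diff linear_relabel norm_relabel)
  then show ?thesis
    by (simp add: sphere_inversion_def linear_add[OF linear_relabel] linear_diff[OF linear_relabel]
        linear_cmul[OF linear_relabel])
qed

lemma borel_measurable_unlabel [measurable]: "unlabel \<in> borel_measurable borel"
proof -
  have "linear (unlabel :: real ^ 'n::finite wo_copy \<Rightarrow> real ^ 'n)"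
    by (auto intro!: linearI simp: unlabel_def vec_eq_iff)
  then show ?thesis
    by (intro borel_measurable_continuous_onI linear_continuous_on) (use linear_conv_bounded_linear in blast)
qed

lemma has_bochner_integral_relabel:
  fixes h :: "real ^ 'n::finite wo_copy \<Rightarrow> real"
  assumes [measurable]: "h \<in> borel_measurable borel"
  shows "has_bochner_integral lborel h I \<longleftrightarrow> has_bochner_integral lborel (\<lambda>y. h (relabel y)) I"
  unfolding has_bochner_integral_iff
  by (subst (1 2) lborel_relabel[symmetric]) (simp add: integrable_distr_eq integral_distr)

lemma inversion_integral:
  fixes h :: "real ^ 'n \<Rightarrow> real"
  assumes l: "l > 0" and h: "integrable lborel h"
  shows "has_bochner_integral lborel
     (\<lambda>y. indicat_real {y. l < norm (y - x)} y * ((l / norm (y - x)) ^ (2 * CARD('n)) * h (sphere_inversion x l y)))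
     (LINT y|lborel. indicat_real {y. norm (y - x) < l} y * h y)"
proof -
  have [measurable]: "h \<in> borel_measurable borel" using h by auto
  have n: "norm (relabel y - relabel x) = norm (y - x)" for y
    by (metis linear_diff linear_relabel norm_relabel)
  define h' where "h' = (\<lambda>z. h (unlabel z))"
  have [measurable]: "h' \<in> borel_measurable borel" unfolding h'_def by measurable
  have "has_bochner_integral lborel h' (integral\<^sup>L lborel h)"
    by (subst has_bochner_integral_relabel) (use h in \<open>auto simp: h'_def has_bochner_integral_iff\<close>)
  then have "integrable lborel h'" by (auto simp: has_bochner_integral_iff)
  note 1 = inversion_integral_wellorder[OF l this, of "relabel x"]
  have "(LINT z|lborel. indicat_real {z. norm (z - relabel x) < l} z * h' z) =
      (LINT y|lborel. indicat_real {y. norm (y - x) < l} y * h y)"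
    by (subst lborel_relabel[symmetric], subst integral_distr) (auto simp: n h'_def indicator_def)
  with 1 show ?thesis
    by (subst (asm) has_bochner_integral_relabel)
      (auto simp: n h'_def indicator_def relabel_sphere_inversion[symmetric] CARD_wo_copy cong: if_cong)
qed

lemma norm_scaled_diff_squared:
  fixes a b :: "'a::real_inner"
  shows "(norm (s *\<^sub>R a - t *\<^sub>R b))\<^sup>2 = s\<^sup>2 * (a \<bullet> a) - 2 * s * t * (a \<bullet> b) + t\<^sup>2 * (b \<bullet> b)"
  unfolding power2_norm_eq_inner
  by (simp add: inner_diff inner_commute power2_eq_square algebra_simps)

text \<open>
  Inversion distorts distances conformally; this is the source of the invariance of the kernel
  \<open>\<bar>z - y\<bar>\<^sup>p\<close> under Kelvin transforms.
\<close>

lemma dist_sphere_inversion: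
  fixes x y z :: "'a::real_inner"
  assumes "y \<noteq> x" "z \<noteq> x"
  shows "norm (sphere_inversion x l z - sphere_inversion x l y) =
    l\<^sup>2 * norm (z - y) / (norm (z - x) * norm (y - x))"
proof -
  define a b where "a = z - x" and "b = y - x"
  have nz: "a \<bullet> a \<noteq> 0" "b \<bullet> b \<noteq> 0" and zy: "z - y = a - b"
    using assms by (auto simp: a_def b_def)
  have "sphere_inversion x l z - sphere_inversion x l y = (l\<^sup>2 / (a \<bullet> a)) *\<^sub>R a - (l\<^sup>2 / (b \<bullet> b)) *\<^sub>R b"
    by (simp add: sphere_inversion_def a_def b_def power2_norm_eq_inner)
  then have "(norm (sphere_inversion x l z - sphere_inversion x l y))\<^sup>2 =
      (l\<^sup>2 / (a \<bullet> a))\<^sup>2 * (a \<bullet> a) - 2 * (l\<^sup>2 / (a \<bullet> a)) * (l\<^sup>2 / (b \<bullet> b)) * (a \<bullet> b) + (l\<^sup>2 / (b \<bullet> b))\<^sup>2 * (b \<bullet> b)"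
    by (simp only: norm_scaled_diff_squared)
  also have "\<dots> = (l\<^sup>2)\<^sup>2 * (a \<bullet> a - 2 * (a \<bullet> b) + b \<bullet> b) / ((a \<bullet> a) * (b \<bullet> b))"
    using nz by (simp add: field_simps power2_eq_square)
  also have "\<dots> = (l\<^sup>2 * norm (z - y) / (norm (z - x) * norm (y - x)))\<^sup>2"
    unfolding zy a_def[symmetric] b_def[symmetric] power_divide power_mult_distrib power2_norm_eq_inner
    by (simp add: inner_diff inner_commute algebra_simps)
  finally show ?thesis
    by (rule power2_eq_imp_eq) auto
qed

text \<open>
  The two points on a common ray, \<open>z\<close> and its rescaled inverse, differ in squared distance to \<open>y\<close> by a
  product of two factors that are positive exactly outside the sphere. It gives the sign of
  the kernel difference as well as its linear growth at the sphere.
\<close>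

lemma norm_inversion_kernel:
  fixes x y z :: "'a::real_inner"
  assumes "l > 0" "z \<noteq> x"
  shows "(norm (z - x) / l * norm (sphere_inversion x l z - y))\<^sup>2 =
    (norm (z - y))\<^sup>2 + ((norm (z - x))\<^sup>2 - l\<^sup>2) * ((norm (y - x))\<^sup>2 - l\<^sup>2) / l\<^sup>2"
proof -
  define a b where "a = z - x" and "b = y - x"
  have nz: "a \<bullet> a \<noteq> 0" and zy: "z - y = a - b"
    using assms by (auto simp: a_def b_def)
  have "sphere_inversion x l z - y = (l\<^sup>2 / (a \<bullet> a)) *\<^sub>R a - b"
    by (simp add: sphere_inversion_def a_def b_def power2_norm_eq_inner)
  then have "(norm (sphere_inversion x l z - y))\<^sup>2 = (l\<^sup>2 / (a \<bullet> a))\<^sup>2 * (a \<bullet> a) - 2 * (l\<^sup>2 / (a \<bullet> a)) * (a \<bullet> b) + b \<bullet> b"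
    using norm_scaled_diff_squared[of "l\<^sup>2 / (a \<bullet> a)" a 1 b] by simp
  then show ?thesis
    using assms(1) nz
    unfolding zy a_def[symmetric] b_def[symmetric] power_divide power_mult_distrib power2_norm_eq_inner
    by (simp add: inner_diff inner_commute field_simps power2_eq_square)
qed

section \<open>Potentials of densities with a moment of order p\<close>

lemma sphere_null: "{y :: 'a::euclidean_space. norm (y - x) = l} \<in> null_sets lborel"
proof -
  have eq: "{y. norm (y - x) = l} = sphere x l" by (auto simp: dist_norm norm_minus_commute)
  have "sphere x l \<in> null_sets lebesgue"
    using negligible_sphere negligible_iff_null_sets by blast
  then show ?thesis
    unfolding eq by (subst (asm) null_sets_completion_iff) auto
qed

lemma powr_add_le:
  fixes a b p :: real
  assumes "a \<ge> 0" "b \<ge> 0" "p \<ge> 0"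
  shows "(a + b) powr p \<le> 2 powr p * (a powr p + b powr p)"
proof -
  have "(a + b) powr p \<le> (2 * max a b) powr p"
    using assms by (intro powr_mono2) auto
  also have "\<dots> = 2 powr p * (max a b powr p)"
    using assms by (simp add: powr_mult)
  also have "\<dots> \<le> 2 powr p * (a powr p + b powr p)"
    by (intro mult_left_mono) (auto simp: max_def)
  finally show ?thesis .
qed

lemma filterlim_norm_diff_at_top:
  assumes "filterlim (\<lambda>k. norm (z k)) at_top G"
  shows "filterlim (\<lambda>k. norm (z k - x)) at_top G"
proof (rule filterlim_at_top_mono)
  show "filterlim (\<lambda>k. - norm x + norm (z k)) at_top G"
    using assms by (rule filterlim_tendsto_add_at_top[OF tendsto_const])
  show "\<forall>\<^sub>F k in G. - norm x + norm (z k) \<le> norm (z k - x)"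
    by (auto intro!: always_eventually simp: norm_triangle_ineq2)
qed

text \<open>
  Strict positivity is confined to the complement of the origin because the density \<open>f \<bar>y\<bar> (u y)\<close> of
  interest carries no information there.
\<close>

locale potential_density =
  fixes p :: real and F :: "real ^ 'n \<Rightarrow> real"
  assumes p_pos: "p > 0"
    and F_nonneg: "\<And>y. F y \<ge> 0"
    and F_pos: "\<And>y. y \<noteq> 0 \<Longrightarrow> F y > 0"
    and F_integrable: "integrable lborel F"
    and F_moment: "integrable lborel (\<lambda>y. norm y powr p * F y)"
begin

definition U :: "real ^ 'n \<Rightarrow> real" where
  "U x = (LINT y|lborel. norm (x - y) powr p * F y)"

lemma F_measurable [measurable]: "F \<in> borel_measurable borel"
  using F_integrable by auto

lemma majorant_integrable: "integrable lborel (\<lambda>y. 2 powr p * (c powr p + norm y powr p) * F y)"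
proof -
  have "integrable lborel (\<lambda>y. (2 powr p * c powr p) * F y + 2 powr p * (norm y powr p * F y))"
    by (intro Bochner_Integration.integrable_add integrable_mult_right F_integrable F_moment)
  then show ?thesis by (simp add: algebra_simps)
qed

lemma kernel_majorant:
  assumes "norm x \<le> c"
  shows "norm (x - y) powr p * F y \<le> 2 powr p * (c powr p + norm y powr p) * F y"
proof (intro mult_right_mono F_nonneg)
  have "norm (x - y) powr p \<le> (c + norm y) powr p"
    using assms p_pos norm_triangle_ineq4[of x y] by (intro powr_mono2) auto
  also have "\<dots> \<le> 2 powr p * (c powr p + norm y powr p)"
    using order_trans[OF norm_ge_zero assms] p_pos by (intro powr_add_le) auto
  finally show "norm (x - y) powr p \<le> 2 powr p * (c powr p + norm y powr p)" .
qed

lemma kernel_integrable: "integrable lborel (\<lambda>y. norm (x - y) powr p * F y)"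
  by (rule Bochner_Integration.integrable_bound[OF majorant_integrable[of "norm x"]])
    (use kernel_majorant[of x "norm x"] F_nonneg in \<open>auto simp: abs_mult intro!: AE_I2\<close>)

lemma U_tendsto:
  assumes "z \<longlonglongrightarrow> w"
  shows "(\<lambda>k. U (z k)) \<longlonglongrightarrow> U w"
proof -
  obtain c where c: "\<And>k. norm (z k) \<le> c"
    using convergent_imp_Bseq[of z] assms by (auto simp: convergent_def Bseq_def)
  show ?thesis unfolding U_def
  proof (rule integral_dominated_convergence[where w = "\<lambda>y. 2 powr p * (c powr p + norm y powr p) * F y"])
    show "AE y in lborel. (\<lambda>k. norm (z k - y) powr p * F y) \<longlonglongrightarrow> norm (w - y) powr p * F y"
      by (intro AE_I2 tendsto_mult tendsto_powr2 tendsto_norm tendsto_diff tendsto_const assms) (use p_pos in auto)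
    show "AE y in lborel. norm (norm (z k - y) powr p * F y) \<le> 2 powr p * (c powr p + norm y powr p) * F y" for k
      using kernel_majorant[OF c] F_nonneg by (auto simp: abs_mult)
  qed (auto intro: majorant_integrable)
qed

lemma U_isCont: "isCont U x"
  using U_tendsto by (auto simp: continuous_at_sequentially o_def)

text \<open>
  By dominated convergence: \<open>\<bar>z - y\<bar> / \<bar>z - x\<bar>\<close> tends to one for each \<open>y\<close>, and it is at most
  \<open>1 + \<bar>x\<bar> + \<bar>y\<bar>\<close> as soon as \<open>\<bar>z - x\<bar>\<close> is at least one.
\<close>

lemma U_growth:
  assumes z: "filterlim (\<lambda>k. norm (z k)) at_top sequentially"
  shows "(\<lambda>k. U (z k) / norm (z k - x) powr p) \<longlonglongrightarrow> (LINT y|lborel. F y)"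
proof -
  have far: "filterlim (\<lambda>k. norm (z k - x)) at_top sequentially"
    using z by (rule filterlim_norm_diff_at_top)
  have pt: "(\<lambda>k. norm (z k - y) / norm (z k - x)) \<longlonglongrightarrow> 1" for y
  proof -
    have "(\<lambda>k. norm (y - x) / norm (z k - x)) \<longlonglongrightarrow> 0"
      using far by (rule real_tendsto_divide_at_top[OF tendsto_const])
    moreover have "\<forall>\<^sub>F k in sequentially. norm (norm (z k - y) / norm (z k - x) - 1) \<le> norm (y - x) / norm (z k - x)"
      using filterlim_at_top_dense[THEN iffD1, OF far, rule_format, of 0]
    proof eventually_elim
      case (elim k)
      have "\<bar>norm (z k - y) - norm (z k - x)\<bar> \<le> norm (y - x)"
        using norm_triangle_ineq3[of "z k - y" "z k - x"] by (simp add: norm_minus_commute)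
      then show ?case using elim by (simp add: field_simps abs_divide diff_divide_eq_iff)
    qed
    ultimately have "(\<lambda>k. norm (z k - y) / norm (z k - x) - 1) \<longlonglongrightarrow> 0"
      by (rule Lim_null_comparison[rotated])
    then show ?thesis by (simp add: LIM_zero_iff)
  qed
  obtain N where N: "\<And>k. k \<ge> N \<Longrightarrow> norm (z k - x) \<ge> 1"
    using filterlim_at_top[THEN iffD1, OF far, rule_format, of 1] by (auto simp: eventually_sequentially)
  have "(\<lambda>k. LINT y|lborel. (norm (z (k + N) - y) / norm (z (k + N) - x)) powr p * F y) \<longlonglongrightarrow> (LINT y|lborel. F y)"
  proof (rule integral_dominated_convergence[where w = "\<lambda>y. 2 powr p * ((1 + norm x) powr p + norm y powr p) * F y"])
    have "(\<lambda>k. (norm (z (k + N) - y) / norm (z (k + N) - x)) powr p * F y) \<longlonglongrightarrow> 1 powr p * F y" for y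
      by (intro tendsto_mult tendsto_powr tendsto_const LIMSEQ_ignore_initial_segment[OF pt]) auto
    then show "AE y in lborel. (\<lambda>k. (norm (z (k + N) - y) / norm (z (k + N) - x)) powr p * F y) \<longlonglongrightarrow> F y"
      by simp
    show "AE y in lborel. norm ((norm (z (k + N) - y) / norm (z (k + N) - x)) powr p * F y)
        \<le> 2 powr p * ((1 + norm x) powr p + norm y powr p) * F y" for k
    proof (rule AE_I2)
      fix y
      let ?d = "norm (z (k + N) - x)"
      have d: "?d \<ge> 1" using N by simp
      have "norm (z (k + N) - y) \<le> ?d + norm (x - y)"
        by (metis norm_diff_triangle_ineq order_refl diff_add_cancel norm_triangle_ineq add_diff_eq)
      also have "\<dots> \<le> ?d * (1 + norm (x - y))"
        using d mult_right_mono[OF d norm_ge_zero[of "x - y"]] by (simp add: algebra_simps)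
      also have "\<dots> \<le> ?d * (1 + norm x + norm y)"
        using d norm_triangle_ineq4[of x y] by (intro mult_left_mono) auto
      finally have "norm (z (k + N) - y) / ?d \<le> 1 + norm x + norm y"
        using d by (simp add: divide_le_eq mult.commute)
      then have "(norm (z (k + N) - y) / ?d) powr p \<le> (1 + norm x + norm y) powr p"
        using p_pos by (intro powr_mono2) auto
      also have "\<dots> \<le> 2 powr p * ((1 + norm x) powr p + norm y powr p)"
        using p_pos by (intro powr_add_le) auto
      finally show "norm ((norm (z (k + N) - y) / ?d) powr p * F y)
        \<le> 2 powr p * ((1 + norm x) powr p + norm y powr p) * F y"
        using F_nonneg[of y] by (simp add: abs_mult mult_right_mono)
    qed
  qed (auto intro: majorant_integrable)
  then have "(\<lambda>k. U (z (k + N)) / norm (z (k + N) - x) powr p) \<longlonglongrightarrow> (LINT y|lborel. F y)"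
    by (simp add: U_def powr_divide mult.commute[of "F _"] flip: Bochner_Integration.integral_divide_zero)
  then show ?thesis by (rule LIMSEQ_offset)
qed

lemma integral_mult_pos:
  assumes S_borel [measurable]: "S \<in> sets borel" and S: "emeasure lborel S > 0"
    and int: "integrable lborel (\<lambda>y. indicat_real S y * h y)" and pos: "\<And>y. y \<in> S \<Longrightarrow> y \<noteq> 0 \<Longrightarrow> h y > 0"
  shows "0 < (LINT y|lborel. indicat_real S y * h y)"
proof -
  have nn: "AE y in lborel. 0 \<le> indicat_real S y * h y"
    using AE_lborel_singleton[of 0] by eventually_elim (use pos in \<open>auto simp: indicator_def less_imp_le\<close>)
  have "(LINT y|lborel. indicat_real S y * h y) \<noteq> 0"
  proof
    assume "(LINT y|lborel. indicat_real S y * h y) = 0"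
    then have "AE y in lborel. indicat_real S y * h y = 0"
      using integral_nonneg_eq_0_iff_AE[OF int nn] by simp
    then have "AE y in lborel. y \<notin> S"
      using AE_lborel_singleton[of 0] by eventually_elim (use pos in \<open>force simp: indicator_def\<close>)
    then show False
      using S S_borel AE_iff_measurable[of S lborel "\<lambda>y. y \<notin> S"] by auto
  qed
  then show ?thesis
    using integral_nonneg_AE[OF nn] by simp
qed

lemma U_pos: "U x > 0"
proof -
  have "0 < (LINT y|lborel. indicat_real (- {x}) y * (norm (x - y) powr p * F y))"
  proof (rule integral_mult_pos)
    have "emeasure lborel (- {x}) = emeasure lborel (UNIV - {x})" by (simp add: Compl_eq_Diff_UNIV)
    also have "\<dots> = emeasure lborel (UNIV :: (real ^ 'n) set)"
      by (subst emeasure_Diff_null_set) auto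
    finally show "0 < emeasure lborel (- {x})" by (simp add: emeasure_lborel_UNIV)
    show "integrable lborel (\<lambda>y. indicat_real (- {x}) y * (norm (x - y) powr p * F y))"
      using integrable_mult_indicator[OF _ kernel_integrable, of "- {x}" x] by simp
  qed (use F_pos in \<open>auto intro!: mult_pos_pos\<close>)
  also have "\<dots> = U x"
    unfolding U_def by (intro Bochner_Integration.integral_cong) (auto simp: indicator_def)
  finally show ?thesis .
qed

text \<open>
  The excess of the density at \<open>y\<close> over the density that its mirror image in the ball contributes
  after folding.
\<close>

definition gain :: "real ^ 'n \<Rightarrow> real \<Rightarrow> real ^ 'n \<Rightarrow> real" where
  "gain x l y = F y - (l / norm (y - x)) powr (p + 2 * real CARD('n)) * F (sphere_inversion x l y)"

text \<open>
  The ball is folded onto the exterior by inversion. If \<open>k\<close> is odd under inversion with the conformal weight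
  \<open>(l / \<bar>y - x\<bar>)\<^sup>p\<close>, the folded contribution combines with the exterior one into the single
  factor \<open>gain\<close>. The lemma is used twice: for the difference of Kelvin transform and potential, and for the leading
  coefficient of that difference at infinity.
\<close>

lemma odd_kernel_integral:
  assumes l: "l > 0" and [measurable]: "k \<in> borel_measurable borel"
    and int: "integrable lborel (\<lambda>y. k y * F y)"
    and odd: "\<And>y. norm (y - x) > l \<Longrightarrow> k (sphere_inversion x l y) = - ((l / norm (y - x)) powr p * k y)"
  shows "has_bochner_integral lborel (\<lambda>y. indicat_real {y. l < norm (y - x)} y * (k y * gain x l y))
    (LINT y|lborel. k y * F y)"
proof -
  let ?out = "{y. l < norm (y - x)}" and ?in = "{y. norm (y - x) < l}"
  note inn = inversion_integral[OF l int, of x]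
  have int': "integrable lborel (\<lambda>y. indicat_real S y * (k y * F y))" if "S \<in> sets borel" for S
    using integrable_mult_indicator[OF _ int, of S] that by simp
  have "(LINT y|lborel. k y * F y) =
      (LINT y|lborel. indicat_real ?out y * (k y * F y) + indicat_real ?in y * (k y * F y))"
    by (rule integral_cong_AE)
      (use AE_not_in[OF sphere_null[of x l]] in \<open>auto elim!: eventually_mono simp: indicator_def\<close>)
  also have "\<dots> = (LINT y|lborel. indicat_real ?out y * (k y * F y)) + (LINT y|lborel. indicat_real ?in y * (k y * F y))"
    by (intro Bochner_Integration.integral_add int') measurable
  finally have "has_bochner_integral lborel (\<lambda>y. indicat_real ?out y * (k y * F y) +
      indicat_real ?out y * ((l / norm (y - x)) ^ (2 * CARD('n)) *
        (k (sphere_inversion x l y) * F (sphere_inversion x l y)))) (LINT y|lborel. k y * F y)"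
    using has_bochner_integral_add[OF has_bochner_integral_integrable[OF int'] inn, of ?out] by simp
  moreover have "indicat_real ?out y * (k y * F y) +
      indicat_real ?out y * ((l / norm (y - x)) ^ (2 * CARD('n)) *
        (k (sphere_inversion x l y) * F (sphere_inversion x l y))) =
      indicat_real ?out y * (k y * gain x l y)" for y
  proof (cases "y \<in> ?out")
    case True
    then have d: "l / norm (y - x) > 0" using l by (intro divide_pos_pos) auto
    have "(l / norm (y - x)) powr (p + 2 * real CARD('n)) = (l / norm (y - x)) powr p * (l / norm (y - x)) ^ (2 * CARD('n))"
      using powr_realpow[OF d, of "2 * CARD('n)"] by (simp add: powr_add)
    then show ?thesis using True odd[of y] by (simp add: gain_def algebra_simps)
  qed auto
  ultimately show ?thesis by simp
qed

end

section \<open>Kelvin transform and reflected kernel\<close>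

lemma sphere_inversion_tendsto:
  assumes "(l \<longlongrightarrow> l0) G" "(z \<longlongrightarrow> z0) G" "z0 \<noteq> x"
  shows "((\<lambda>k. sphere_inversion x (l k) (z k)) \<longlongrightarrow> sphere_inversion x l0 z0) G"
  unfolding sphere_inversion_def by (intro tendsto_intros assms) (use assms in auto)

text \<open>
  A lower bound for the increment of a power that covers the exponents below and above one alike.
\<close>

lemma powr_diff_ge:
  fixes a b q :: real
  assumes "0 < b" "b \<le> a" "0 < q"
  shows "q * b powr q * ((a - b) / a) \<le> a powr q - b powr q"
proof -
  have a: "a > 0" using assms by linarith
  have "(a - b) / a \<le> ln (a / b)"
    using ln_le_minus_one[of "b / a"] assms a by (simp add: ln_div diff_divide_distrib)
  then have "1 + q * ((a - b) / a) \<le> exp (q * ln (a / b))"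
    using exp_ge_add_one_self[of "q * ln (a / b)"] mult_left_mono[of "(a - b) / a" "ln (a / b)" q] assms by linarith
  also have "\<dots> = (a / b) powr q" using assms a by (simp add: powr_def)
  also have "\<dots> = a powr q / b powr q" using assms a by (simp add: powr_divide)
  finally show ?thesis
    using assms by (simp add: field_simps)
qed

context potential_density
begin

definition kelvin :: "real ^ 'n \<Rightarrow> real \<Rightarrow> real ^ 'n \<Rightarrow> real" where
  "kelvin x l z = (norm (z - x) / l) powr p * U (sphere_inversion x l z)"

definition kernel_gap :: "real ^ 'n \<Rightarrow> real \<Rightarrow> real ^ 'n \<Rightarrow> real ^ 'n \<Rightarrow> real" where
  "kernel_gap x l z y = (norm (z - x) / l * norm (sphere_inversion x l z - y)) powr p - norm (z - y) powr p"

lemma kelvin_tendsto: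
  assumes "(l \<longlonglongrightarrow> l0)" "(z \<longlonglongrightarrow> z0)" "z0 \<noteq> x" "l0 > 0"
  shows "(\<lambda>k. kelvin x (l k) (z k)) \<longlonglongrightarrow> kelvin x l0 z0"
  unfolding kelvin_def
  by (intro tendsto_intros U_tendsto sphere_inversion_tendsto assms) (use assms in auto)

lemma kelvin_minus_U:
  assumes l: "l > 0" and z: "z \<noteq> x"
  shows "has_bochner_integral lborel (\<lambda>y. indicat_real {y. l < norm (y - x)} y * (kernel_gap x l z y * gain x l y))
    (kelvin x l z - U z)"
proof -
  have eq: "kernel_gap x l z y * F y = (norm (z - x) / l) powr p * (norm (sphere_inversion x l z - y) powr p * F y)
      - norm (z - y) powr p * F y" for y
    using l powr_mult[of "norm (z - x) / l" "norm (sphere_inversion x l z - y)" p]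
    by (simp add: kernel_gap_def left_diff_distrib)
  have "kernel_gap x l z (sphere_inversion x l y) = - ((l / norm (y - x)) powr p * kernel_gap x l z y)"
    if y: "l < norm (y - x)" for y
  proof -
    let ?zs = "sphere_inversion x l z"
    have yx: "y \<noteq> x" "norm (y - x) > 0" using y l by auto
    have zsx: "?zs \<noteq> x" using norm_sphere_inversion[of x l z] z l by auto
    have 1: "norm (z - x) / l * norm (?zs - sphere_inversion x l y) = l / norm (y - x) * norm (z - y)"
      using dist_sphere_inversion[OF yx(1) z, of l] z l yx by (simp add: power2_eq_square field_simps)
    have "norm (z - sphere_inversion x l y) = l\<^sup>2 * norm (?zs - y) / (norm (?zs - x) * norm (y - x))"
      using dist_sphere_inversion[OF yx(1) zsx, of l] sphere_inversion_involution[OF z, of l] l by simp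
    also have "\<dots> = l / norm (y - x) * (norm (z - x) / l * norm (?zs - y))"
      using z l yx by (simp add: norm_sphere_inversion field_simps power2_eq_square)
    finally have 2: "norm (z - sphere_inversion x l y) = l / norm (y - x) * (norm (z - x) / l * norm (?zs - y))" .
    show ?thesis
      unfolding kernel_gap_def 1 2
      using l powr_mult[of "l / norm (y - x)" "norm (z - y)" p]
        powr_mult[of "l / norm (y - x)" "norm (z - x) / l * norm (?zs - y)" p]
      by (simp add: right_diff_distrib)
  qed
  moreover have "integrable lborel (\<lambda>y. kernel_gap x l z y * F y)"
    unfolding eq by (intro Bochner_Integration.integrable_diff integrable_mult_right kernel_integrable)
  moreover have "(LINT y|lborel. kernel_gap x l z y * F y) = kelvin x l z - U z"
    unfolding eq kelvin_def U_def
    by (subst Bochner_Integration.integral_diff) (auto intro: kernel_integrable)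
  moreover have "kernel_gap x l z \<in> borel_measurable borel"
    unfolding kernel_gap_def by measurable
  ultimately show ?thesis
    using odd_kernel_integral[OF l, of "kernel_gap x l z" x] by simp
qed

text \<open>
  After division by \<open>\<bar>z - x\<bar>\<^sup>p\<close>, the Kelvin transform tends to \<open>U x / l\<^sup>p\<close> and the potential to the total
  mass. So this is the analogue of \<open>kelvin_minus_U\<close> at infinity.
\<close>

lemma center_minus_mass:
  assumes l: "l > 0"
  shows "has_bochner_integral lborel
    (\<lambda>y. indicat_real {y. l < norm (y - x)} y * (((norm (y - x) / l) powr p - 1) * gain x l y))
    (U x / l powr p - (LINT y|lborel. F y))"
proof -
  have eq: "((norm (y - x) / l) powr p - 1) * F y = norm (x - y) powr p * F y / l powr p - F y" for y
    using l by (simp add: powr_divide norm_minus_commute algebra_simps)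
  have "(norm (sphere_inversion x l y - x) / l) powr p - 1 = - ((l / norm (y - x)) powr p * ((norm (y - x) / l) powr p - 1))"
    if y: "l < norm (y - x)" for y
  proof -
    have "norm (y - x) > 0" using y l by linarith
    moreover have "norm (sphere_inversion x l y - x) / l = l / norm (y - x)"
      using l by (simp add: norm_sphere_inversion power2_eq_square)
    ultimately show ?thesis
      using l by (simp add: algebra_simps powr_divide)
  qed
  moreover have "integrable lborel (\<lambda>y. ((norm (y - x) / l) powr p - 1) * F y)"
    unfolding eq by (intro Bochner_Integration.integrable_diff integrable_divide kernel_integrable F_integrable)
  moreover have "(LINT y|lborel. ((norm (y - x) / l) powr p - 1) * F y) = U x / l powr p - (LINT y|lborel. F y)"
    unfolding eq U_def
    by (subst Bochner_Integration.integral_diff) (auto intro: kernel_integrable F_integrable)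
  ultimately show ?thesis
    using odd_kernel_integral[OF l, of "\<lambda>y. (norm (y - x) / l) powr p - 1" x] by simp
qed

lemma kernel_gap_pos:
  assumes "l > 0" "l < norm (z - x)" "l < norm (y - x)"
  shows "kernel_gap x l z y > 0"
proof -
  have "z \<noteq> x" using assms by auto
  moreover have "((norm (z - x))\<^sup>2 - l\<^sup>2) * ((norm (y - x))\<^sup>2 - l\<^sup>2) / l\<^sup>2 > 0"
    using assms by (intro divide_pos_pos mult_pos_pos) (auto simp: power_strict_mono)
  ultimately have "(norm (z - y))\<^sup>2 < (norm (z - x) / l * norm (sphere_inversion x l z - y))\<^sup>2"
    using assms norm_inversion_kernel[of l z x y] by linarith
  then have "norm (z - y) < norm (z - x) / l * norm (sphere_inversion x l z - y)"
    by (rule power2_less_imp_less) (use assms in auto)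
  then show ?thesis
    using p_pos by (simp add: kernel_gap_def powr_less_mono2)
qed

text \<open>
  The difference of squared distances grows linearly with the distance of \<open>z\<close> from the sphere, uniformly
  for \<open>y\<close> in a fixed annulus. In that annulus \<open>\<bar>z - y\<bar>\<close> stays between \<open>l / 2\<close> and \<open>9 l / 2\<close>, which keeps the
  passage from squares to powers uniform; the constant 31 bounds the larger square by
  \<open>(81 / 4 + 10) l\<^sup>2 \<le> 31 l\<^sup>2\<close>.
\<close>

lemma kernel_gap_hopf:
  assumes l: "l > 0" and z: "l < norm (z - x)" "norm (z - x) < 3 / 2 * l"
    and y: "2 * l < norm (y - x)" "norm (y - x) < 3 * l"
  shows "p / 2 * ((l / 2)\<^sup>2) powr (p / 2) * 6 / (31 * l) * (norm (z - x) - l) \<le> kernel_gap x l z y"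
proof -
  let ?r = "norm (z - x)" and ?s = "norm (y - x)"
  define A where "A = (?r / l * norm (sphere_inversion x l z - y))\<^sup>2"
  define B where "B = (norm (z - y))\<^sup>2"
  have zx: "z \<noteq> x" using assms by auto
  have AB: "A - B = (?r\<^sup>2 - l\<^sup>2) * (?s\<^sup>2 - l\<^sup>2) / l\<^sup>2"
    using norm_inversion_kernel[OF l zx, of y] by (simp add: A_def B_def)
  have "?s - ?r \<le> norm (z - y)"
    using norm_triangle_ineq2[of "y - x" "z - x"] by (simp add: norm_minus_commute)
  then have zy: "l / 2 \<le> norm (z - y)" using z y by linarith
  then have B: "(l / 2)\<^sup>2 \<le> B" unfolding B_def using l by (intro power_mono) auto
  have r2: "l\<^sup>2 \<le> ?r\<^sup>2" "?r\<^sup>2 \<le> (3 / 2 * l)\<^sup>2" and s2: "(2 * l)\<^sup>2 \<le> ?s\<^sup>2" "?s\<^sup>2 \<le> (3 * l)\<^sup>2"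
    using z y l by (intro power_mono; linarith)+
  have "norm (z - y) \<le> ?r + ?s"
    using norm_triangle_ineq4[of "z - x" "y - x"] by simp
  then have "norm (z - y) \<le> 9 / 2 * l" using z y by linarith
  then have "B \<le> (9 / 2 * l)\<^sup>2" unfolding B_def using l by (intro power_mono) auto
  moreover have "A - B \<le> ((3 / 2 * l)\<^sup>2 - l\<^sup>2) * ((3 * l)\<^sup>2 - l\<^sup>2) / l\<^sup>2"
    unfolding AB using r2 s2 l by (intro divide_right_mono mult_mono) (auto simp: power2_eq_square)
  moreover have "(9 / 2 * l)\<^sup>2 = 81 / 4 * l\<^sup>2" "((3 / 2 * l)\<^sup>2 - l\<^sup>2) * ((3 * l)\<^sup>2 - l\<^sup>2) / l\<^sup>2 = 10 * l\<^sup>2"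
    using l by (simp_all add: power2_eq_square field_simps)
  ultimately have A31: "A \<le> 31 * l\<^sup>2"
    using zero_le_power2[of l] by linarith
  have "6 * l * (?r - l) = (2 * l * (?r - l)) * (3 * l\<^sup>2) / l\<^sup>2"
    using l by (simp add: field_simps)
  also have "\<dots> \<le> A - B"
  proof -
    have "2 * l * (?r - l) \<le> ?r\<^sup>2 - l\<^sup>2"
      using mult_right_mono[of "2 * l" "?r + l" "?r - l"] z by (simp add: power2_eq_square algebra_simps)
    then show ?thesis
      unfolding AB using r2 s2 l z by (intro divide_right_mono mult_mono) (auto simp: power2_eq_square)
  qed
  finally have ABlow: "6 * l * (?r - l) \<le> A - B" .
  have B0: "0 < (l / 2)\<^sup>2" using l by simp
  have Ba: "B \<le> A" using ABlow mult_nonneg_nonneg[of "6 * l" "?r - l"] l z by linarith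
  have A0: "A > 0" using B0 B Ba by linarith
  have "p / 2 * ((l / 2)\<^sup>2) powr (p / 2) * 6 / (31 * l) * (?r - l)
      = p / 2 * ((l / 2)\<^sup>2) powr (p / 2) * ((6 * l * (?r - l)) / (31 * l\<^sup>2))"
    using l by (simp add: power2_eq_square field_simps)
  also have "\<dots> \<le> p / 2 * B powr (p / 2) * ((A - B) / A)"
    using p_pos B0 B A0 A31 ABlow Ba l z
    by (intro mult_mono powr_mono2 frac_le) auto
  also have "\<dots> \<le> A powr (p / 2) - B powr (p / 2)"
    using powr_diff_ge[of B A "p / 2"] B0 B Ba p_pos by linarith
  also have "\<dots> = kernel_gap x l z y"
    unfolding A_def B_def kernel_gap_def using l by (simp add: powr_powr flip: powr_numeral)
  finally show ?thesis .
qed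

end

section \<open>Admissible radii\<close>

text \<open>
  The last assumption is the form in which the structural condition on the nonlinearity enters: where \<open>U\<close> does not
  exceed its Kelvin transform, folding leaves a positive density.
\<close>

locale moving_spheres = potential_density p F for p :: real and F :: "real ^ 'n \<Rightarrow> real" +
  fixes U' :: "real ^ 'n \<Rightarrow> ((real ^ 'n) \<Rightarrow>\<^sub>L real)"
  assumes U_deriv: "\<And>y. y \<noteq> 0 \<Longrightarrow> (U has_derivative blinfun_apply (U' y)) (at y)"
    and U'_cont: "continuous_on (- {0}) U'"
    and gain_pos: "\<And>x l z. \<lbrakk>x \<noteq> 0; 0 < l; l < norm x; l < norm (z - x); z \<noteq> 0; U z \<le> kelvin x l z\<rbrakk> \<Longrightarrow> 0 < gain x l z"
begin

definition admissible :: "real ^ 'n \<Rightarrow> real \<Rightarrow> bool" where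
  "admissible x l \<longleftrightarrow> (\<forall>z. l < norm (z - x) \<longrightarrow> U z \<le> kelvin x l z)"

lemma emeasure_open_pos:
  fixes S :: "(real ^ 'n) set"
  assumes "open S" "S \<noteq> {}"
  shows "emeasure lborel S > 0"
proof (rule ccontr)
  assume "\<not> 0 < emeasure lborel S"
  then have "S \<in> null_sets lborel" using assms(1) by (simp add: null_sets_def)
  then show False
    using open_not_negligible[OF assms] null_sets_completionI negligible_iff_null_sets by blast
qed

lemma annulus_open_nonempty:
  fixes x :: "real ^ 'n"
  assumes "0 \<le> a" "a < b"
  shows "open {y. a < norm (y - x) \<and> norm (y - x) < b}" "{y. a < norm (y - x) \<and> norm (y - x) < b} \<noteq> {}"
proof -
  show "open {y. a < norm (y - x) \<and> norm (y - x) < b}"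
    by (intro open_Collect_conj open_Collect_less continuous_intros)
  obtain e :: "real ^ 'n" where "norm e = 1" using vector_choose_size[of 1] by auto
  then have "x + ((a + b) / 2) *\<^sub>R e \<in> {y. a < norm (y - x) \<and> norm (y - x) < b}"
    using assms by simp
  then show "{y. a < norm (y - x) \<and> norm (y - x) < b} \<noteq> {}" by blast
qed

text \<open>
  For an admissible radius the gain is positive in the exterior, except perhaps at the origin, and a nonempty open annulus carries positive
  measure.
\<close>

lemma weighted_gain_pos:
  assumes x: "x \<noteq> 0" and l: "0 < l" "l < norm x" and adm: "admissible x l"
    and ab: "l \<le> a" "a < b" and k: "\<And>y. l < norm (y - x) \<Longrightarrow> k y > 0"
    and int: "integrable lborel (\<lambda>y. indicat_real {y. l < norm (y - x)} y * (k y * gain x l y))"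
  shows "integrable lborel (\<lambda>y. indicat_real {y. a < norm (y - x) \<and> norm (y - x) < b} y * (k y * gain x l y))"
    and "0 < (LINT y|lborel. indicat_real {y. a < norm (y - x) \<and> norm (y - x) < b} y * (k y * gain x l y))"
proof -
  let ?A = "{y. a < norm (y - x) \<and> norm (y - x) < b}"
  have A: "open ?A" "?A \<noteq> {}" using annulus_open_nonempty[of a b x] l ab by auto
  have "(\<lambda>y. indicat_real ?A y * (k y * gain x l y)) =
      (\<lambda>y. indicat_real ?A y *\<^sub>R (indicat_real {y. l < norm (y - x)} y * (k y * gain x l y)))"
    using ab by (auto simp: indicator_def fun_eq_iff)
  then show int': "integrable lborel (\<lambda>y. indicat_real ?A y * (k y * gain x l y))"
    using integrable_mult_indicator[OF _ int, of ?A] A by simp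
  show "0 < (LINT y|lborel. indicat_real ?A y * (k y * gain x l y))"
  proof (rule integral_mult_pos[OF _ emeasure_open_pos[OF A] int'])
    fix y assume "y \<in> ?A" "y \<noteq> 0"
    then show "0 < k y * gain x l y"
      using ab k gain_pos[OF x l, of y] adm by (auto simp: admissible_def)
  qed (use A in simp)
qed

text \<open>
  All strict improvements of an admissible inequality come from this comparison: shrinking the exterior to
  an annulus and lowering the weight there can only decrease the integral.
\<close>

lemma gain_weight_mono:
  assumes x: "x \<noteq> 0" and l: "0 < l" "l < norm x" and adm: "admissible x l"
    and ab: "l \<le> a" "a < b" and k1: "\<And>y. l < norm (y - x) \<Longrightarrow> k1 y > 0" and k2: "\<And>y. l < norm (y - x) \<Longrightarrow> k2 y > 0"
    and le: "\<And>y. a < norm (y - x) \<Longrightarrow> norm (y - x) < b \<Longrightarrow> c * k1 y \<le> k2 y"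
    and int1: "integrable lborel (\<lambda>y. indicat_real {y. l < norm (y - x)} y * (k1 y * gain x l y))"
    and int2: "integrable lborel (\<lambda>y. indicat_real {y. l < norm (y - x)} y * (k2 y * gain x l y))"
  shows "c * (LINT y|lborel. indicat_real {y. a < norm (y - x) \<and> norm (y - x) < b} y * (k1 y * gain x l y))
    \<le> (LINT y|lborel. indicat_real {y. l < norm (y - x)} y * (k2 y * gain x l y))"
proof -
  let ?A = "{y. a < norm (y - x) \<and> norm (y - x) < b}"
  have "c * (LINT y|lborel. indicat_real ?A y * (k1 y * gain x l y))
      = (LINT y|lborel. c * (indicat_real ?A y * (k1 y * gain x l y)))" by simp
  also have "\<dots> \<le> (LINT y|lborel. indicat_real {y. l < norm (y - x)} y * (k2 y * gain x l y))"
  proof (rule integral_mono_AE[OF integrable_mult_right[OF weighted_gain_pos(1)[OF x l adm ab k1 int1]] int2])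
    show "AE y in lborel. c * (indicat_real ?A y * (k1 y * gain x l y))
        \<le> indicat_real {y. l < norm (y - x)} y * (k2 y * gain x l y)"
      using AE_lborel_singleton[of 0]
    proof eventually_elim
      case (elim y)
      show ?case
      proof (cases "l < norm (y - x)")
        case True
        then have g: "gain x l y > 0" using gain_pos[OF x l True elim] adm by (simp add: admissible_def)
        show ?thesis
        proof (cases "y \<in> ?A")
          case A: True
          then have "c * k1 y * gain x l y \<le> k2 y * gain x l y" using le[of y] g by (intro mult_right_mono) auto
          then show ?thesis using A True by (simp add: mult.assoc)
        next
          case False
          then have "indicat_real ?A y = 0" by simp
          then show ?thesis using True mult_pos_pos[OF k2[OF True] g] by simp
        qed
      next
        case False
        then show ?thesis using ab by (simp add: indicator_def)
      qed
    qed
  qed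
  finally show ?thesis .
qed

lemma admissible_strict:
  assumes "x \<noteq> 0" and l: "0 < l" "l < norm x" and "admissible x l" and z: "l < norm (z - x)"
  shows "U z < kelvin x l z"
proof -
  have zx: "z \<noteq> x" using l z by auto
  note K = kelvin_minus_U[OF l(1) zx]
  have Kint: "integrable lborel (\<lambda>y. indicat_real {y. l < norm (y - x)} y * (kernel_gap x l z y * gain x l y))"
    using K by (simp add: has_bochner_integral_iff)
  have pos: "\<And>y. l < norm (y - x) \<Longrightarrow> kernel_gap x l z y > 0" using kernel_gap_pos[OF l(1) z] .
  have ll: "l \<le> l" "l < l + 1" by auto
  show ?thesis
    using weighted_gain_pos(2)[OF assms(1) l assms(4) ll pos Kint]
      gain_weight_mono[OF assms(1) l assms(4) ll pos pos _ Kint Kint, of 1] K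
    by (simp add: has_bochner_integral_iff)
qed

lemma center_weight_pos:
  assumes "0 < l" "l < d"
  shows "(d / l) powr p - 1 > 0"
  using powr_less_mono2[of p 1 "d / l"] assms p_pos by simp

lemma admissible_mass:
  assumes "x \<noteq> 0" and l: "0 < l" "l < norm x" and "admissible x l"
  shows "(LINT y|lborel. F y) < U x / l powr p"
proof -
  note K = center_minus_mass[OF l(1), of x]
  have Kint: "integrable lborel (\<lambda>y. indicat_real {y. l < norm (y - x)} y * (((norm (y - x) / l) powr p - 1) * gain x l y))"
    using K by (simp add: has_bochner_integral_iff)
  have ll: "l \<le> l" "l < l + 1" by auto
  show ?thesis
    using weighted_gain_pos(2)[OF assms(1) l assms(4) ll center_weight_pos[OF l(1)] Kint]
      gain_weight_mono[OF assms(1) l assms(4) ll center_weight_pos[OF l(1)] center_weight_pos[OF l(1)] _ Kint Kint, of 1] K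
    by (simp add: has_bochner_integral_iff)
qed

text \<open>
  A quantitative form of the Hopf boundary lemma. The kernel gap grows linearly off the
  sphere, uniformly over the annulus \<open>2 l < \<bar>y - x\<bar> < 3 l\<close>. The integrand of \<open>center_minus_mass\<close> on that
  annulus serves as the reference, since its integrability is already known.
\<close>

lemma admissible_hopf:
  assumes "x \<noteq> 0" and l: "0 < l" "l < norm x" and "admissible x l"
  shows "\<exists>c>0. \<forall>z. l < norm (z - x) \<longrightarrow> norm (z - x) < 3 / 2 * l \<longrightarrow> c * (norm (z - x) - l) \<le> kelvin x l z - U z"
proof -
  let ?k1 = "\<lambda>y. (norm (y - x) / l) powr p - 1"
  have Kint1: "integrable lborel (\<lambda>y. indicat_real {y. l < norm (y - x)} y * (?k1 y * gain x l y))"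
    using center_minus_mass[OF l(1), of x] by (simp add: has_bochner_integral_iff)
  have ab: "l \<le> 2 * l" "2 * l < 3 * l" using l by auto
  define J where "J = (LINT y|lborel. indicat_real {y. 2 * l < norm (y - x) \<and> norm (y - x) < 3 * l} y * (?k1 y * gain x l y))"
  have J: "J > 0"
    unfolding J_def by (rule weighted_gain_pos(2)[OF assms(1) l assms(4) ab center_weight_pos[OF l(1)] Kint1])
  define c where "c = p / 2 * ((l / 2)\<^sup>2) powr (p / 2) * 6 / (31 * l)"
  have c: "c > 0" unfolding c_def using l p_pos by simp
  show ?thesis
  proof (intro exI[of _ "c / 3 powr p * J"] conjI allI impI)
    show "0 < c / 3 powr p * J" using c J by simp
    fix z assume z: "l < norm (z - x)" "norm (z - x) < 3 / 2 * l"
    have zx: "z \<noteq> x" using l z by auto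
    note K = kelvin_minus_U[OF l(1) zx]
    have Kint: "integrable lborel (\<lambda>y. indicat_real {y. l < norm (y - x)} y * (kernel_gap x l z y * gain x l y))"
      using K by (simp add: has_bochner_integral_iff)
    have "c / 3 powr p * (norm (z - x) - l) * ?k1 y \<le> kernel_gap x l z y"
      if y: "2 * l < norm (y - x)" "norm (y - x) < 3 * l" for y
    proof -
      have "(norm (y - x) / l) powr p \<le> 3 powr p"
        using y l p_pos by (intro powr_mono2) (auto simp: divide_le_eq)
      then have "?k1 y \<le> 3 powr p" by simp
      then have "c / 3 powr p * (norm (z - x) - l) * ?k1 y \<le> c / 3 powr p * (norm (z - x) - l) * 3 powr p"
        using c z by (intro mult_left_mono) auto
      also have "\<dots> = c * (norm (z - x) - l)" by simp
      also have "\<dots> \<le> kernel_gap x l z y"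
        unfolding c_def using kernel_gap_hopf[OF l(1) z y] .
      finally show ?thesis .
    qed
    from gain_weight_mono[OF assms(1) l assms(4) ab center_weight_pos[OF l(1)] kernel_gap_pos[OF l(1) z(1)] this Kint1 Kint]
    show "c / 3 powr p * J * (norm (z - x) - l) \<le> kelvin x l z - U z"
      using K by (simp add: has_bochner_integral_iff J_def mult_ac)
  qed
qed

end

lemma obtain_approximating_sequence:
  fixes l :: real
  assumes "\<forall>e>0. \<exists>l'. \<bar>l' - l\<bar> < e \<and> P l'"
  obtains s where "s \<longlonglongrightarrow> l" "\<And>k::nat. P (s k)"
proof -
  have "\<forall>k::nat. \<exists>l'. \<bar>l' - l\<bar> < inverse (real (Suc k)) \<and> P l'" using assms by simp
  then obtain s where s: "\<And>k::nat. \<bar>s k - l\<bar> < inverse (real (Suc k))" "\<And>k. P (s k)" by metis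
  have "(\<lambda>k. s k - l) \<longlonglongrightarrow> 0"
    by (rule Lim_null_comparison[OF _ LIMSEQ_inverse_real_of_nat])
      (use s(1) in \<open>auto intro!: always_eventually less_imp_le\<close>)
  then show ?thesis using that s(2) by (simp add: LIM_zero_iff)
qed

lemma subsequence_converges_or_escapes:
  fixes z :: "nat \<Rightarrow> 'a::euclidean_space"
  obtains r where "strict_mono r" "(\<exists>w. (z \<circ> r) \<longlonglongrightarrow> w) \<or> filterlim (\<lambda>k. norm (z (r k))) at_top sequentially"
proof (cases "filterlim (\<lambda>k. norm (z k)) at_top sequentially")
  case True
  then show ?thesis using that[of id] strict_mono_id by simp
next
  case False
  then obtain M where M: "\<not> (\<forall>\<^sub>F k in sequentially. M \<le> norm (z k))"
    by (auto simp: filterlim_at_top)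
  have "infinite {k. norm (z k) \<le> M}"
    using M by (auto simp: infinite_nat_iff_unbounded_le eventually_sequentially)
      (metis linorder_not_le less_imp_le)
  then obtain r1 :: "nat \<Rightarrow> nat" where r1: "strict_mono r1" "\<And>k. norm (z (r1 k)) \<le> M"
    using infinite_enumerate[of "{k. norm (z k) \<le> M}"] by auto
  then have "\<forall>k. (z \<circ> r1) k \<in> cball 0 M" by simp
  then obtain w r2 where "strict_mono r2" "((z \<circ> r1) \<circ> r2) \<longlonglongrightarrow> w"
    using compact_cball[of "0::'a" M] unfolding compact_def by metis
  then show ?thesis
    using that[of "r1 \<circ> r2"] r1(1) strict_mono_o by (auto simp: o_assoc)
qed

context moving_spheres
begin

lemma kelvin_ray:
  assumes "r > 0" "norm \<theta> = 1"
  shows "kelvin x l (x + r *\<^sub>R \<theta>) = (r / l) powr p * U (x + (l\<^sup>2 / r) *\<^sub>R \<theta>)"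
  using assms by (simp add: kelvin_def sphere_inversion_def power2_eq_square)

lemma ray_nonzero:
  assumes "norm \<theta> = 1" "0 \<le> t" "t < norm x"
  shows "x + t *\<^sub>R \<theta> \<noteq> 0"
proof
  assume "x + t *\<^sub>R \<theta> = 0"
  then have "norm x = norm (t *\<^sub>R \<theta>)" by (metis add_eq_0_iff norm_minus_cancel)
  then show False using assms by simp
qed

lemma U_ray_derivative:
  assumes "norm \<theta> = 1" "0 \<le> t" "t < norm x"
  shows "((\<lambda>t. U (x + t *\<^sub>R \<theta>)) has_real_derivative U' (x + t *\<^sub>R \<theta>) \<theta>) (at t)"
proof -
  have "((\<lambda>t. x + t *\<^sub>R \<theta>) has_derivative (\<lambda>h. h *\<^sub>R \<theta>)) (at t)"
    by (auto intro!: derivative_eq_intros)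
  from has_derivative_compose[OF this U_deriv[OF ray_nonzero[OF assms]]]
  show ?thesis
    by (simp add: has_field_derivative_def blinfun.scaleR_right mult.commute[of "_ \<theta>"] mult_commute_abs)
qed

text \<open>
  On the ray with direction \<open>\<theta>\<close> the Kelvin inequality compares \<open>t\<^sup>-\<^sup>p\<^sup>/\<^sup>2 U(x + t \<theta>)\<close> at the two radii
  \<open>l\<^sup>2 / r\<close> and \<open>r\<close>. If it fails, the mean value theorem for the logarithm of that function produces a radius in
  between where it increases.
\<close>

lemma ray_mvt:
  assumes l: "0 < l" "l < r" "r < norm x" and \<theta>: "norm \<theta> = 1"
    and bad: "kelvin x l (x + r *\<^sub>R \<theta>) < U (x + r *\<^sub>R \<theta>)"
  obtains t where "l\<^sup>2 / r < t" "t < r" "p / (2 * t) * U (x + t *\<^sub>R \<theta>) < U' (x + t *\<^sub>R \<theta>) \<theta>"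
proof -
  define s where "s = l\<^sup>2 / r"
  define \<psi> where "\<psi> = (\<lambda>t. ln (U (x + t *\<^sub>R \<theta>)) - p / 2 * ln t)"
  have s: "0 < s" "s < r"
    using l by (auto simp: s_def power2_eq_square divide_less_eq intro: mult_strict_mono)
  have der: "(\<psi> has_real_derivative U' (x + t *\<^sub>R \<theta>) \<theta> / U (x + t *\<^sub>R \<theta>) - p / 2 / t) (at t)"
    if "s \<le> t" "t \<le> r" for t
    unfolding \<psi>_def using that s l U_pos[of "x + t *\<^sub>R \<theta>"]
    by (auto intro!: derivative_eq_intros U_ray_derivative \<theta>)
  obtain t where t: "s < t" "t < r"
      "\<psi> r - \<psi> s = (r - s) * (U' (x + t *\<^sub>R \<theta>) \<theta> / U (x + t *\<^sub>R \<theta>) - p / 2 / t)"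
    using MVT2[OF s(2) der] by blast
  have "ln ((r / l) powr p * U (x + s *\<^sub>R \<theta>)) < ln (U (x + r *\<^sub>R \<theta>))"
    using bad l U_pos[of "x + s *\<^sub>R \<theta>"] \<theta> by (subst ln_less_cancel_iff) (auto simp: kelvin_ray s_def U_pos)
  then have "p * (ln r - ln l) + ln (U (x + s *\<^sub>R \<theta>)) < ln (U (x + r *\<^sub>R \<theta>))"
    using l U_pos[of "x + s *\<^sub>R \<theta>"] by (simp add: ln_mult ln_powr ln_div)
  moreover have lns: "ln s = 2 * ln l - ln r"
    using l by (simp add: s_def ln_div ln_realpow)
  moreover have "\<psi> r - \<psi> s = ln (U (x + r *\<^sub>R \<theta>)) - ln (U (x + s *\<^sub>R \<theta>)) - p * (ln r - ln l)"
    by (simp add: \<psi>_def lns field_simps)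
  ultimately have "\<psi> r - \<psi> s > 0" by linarith
  then have "p / 2 / t < U' (x + t *\<^sub>R \<theta>) \<theta> / U (x + t *\<^sub>R \<theta>)"
    using t s by (simp add: zero_less_mult_iff)
  then have "p / (2 * t) * U (x + t *\<^sub>R \<theta>) < U' (x + t *\<^sub>R \<theta>) \<theta>"
    using U_pos[of "x + t *\<^sub>R \<theta>"] by (simp add: less_divide_eq)
  then show ?thesis using that t by (simp add: s_def)
qed

text \<open>
  On the sphere, where \<open>U\<close> agrees with its Kelvin transform, the derivative of their difference along the outward
  ray is \<open>2 (p / (2 l) U - \<partial>U)\<close>, and the Hopf bound makes it positive.
\<close>

lemma boundary_slope:
  assumes x: "x \<noteq> 0" and l: "0 < l" "l < norm x" and adm: "admissible x l" and \<theta>: "norm \<theta> = 1"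
  shows "U' (x + l *\<^sub>R \<theta>) \<theta> < p / (2 * l) * U (x + l *\<^sub>R \<theta>)"
proof (rule ccontr)
  assume neg: "\<not> ?thesis"
  obtain c where c: "c > 0" and hopf: "\<And>z. l < norm (z - x) \<Longrightarrow> norm (z - x) < 3 / 2 * l \<Longrightarrow>
      c * (norm (z - x) - l) \<le> kelvin x l z - U z"
    using admissible_hopf[OF x l adm] by auto
  define \<Phi> where "\<Phi> = (\<lambda>r. (r / l) powr p * U (x + (l\<^sup>2 / r) *\<^sub>R \<theta>) - U (x + r *\<^sub>R \<theta>) - c * (r - l))"
  let ?D = "U' (x + l *\<^sub>R \<theta>) \<theta>"
  have ll: "l\<^sup>2 / l = l" using l by (simp add: power2_eq_square)
  have inner: "((\<lambda>r. l\<^sup>2 / r) has_real_derivative - 1) (at l)"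
    using l by (auto intro!: derivative_eq_intros simp: power2_eq_square)
  have ray: "((\<lambda>t. U (x + t *\<^sub>R \<theta>)) has_real_derivative ?D) (at l)"
    using U_ray_derivative[OF \<theta>] l by simp
  have comp: "((\<lambda>r. U (x + (l\<^sup>2 / r) *\<^sub>R \<theta>)) has_real_derivative ?D * - 1) (at l)"
    by (rule DERIV_chain2[OF _ inner]) (simp only: ll ray)
  have pow: "((\<lambda>r. (r / l) powr p) has_real_derivative p / l) (at l)"
    using l by (auto intro!: derivative_eq_intros)
  have "(\<Phi> has_real_derivative (p / l * U (x + (l\<^sup>2 / l) *\<^sub>R \<theta>) + ?D * - 1 * (l / l) powr p) - ?D - c * (1 - 0)) (at l)"
    unfolding \<Phi>_def
    by (intro DERIV_diff DERIV_mult DERIV_cmult DERIV_ident DERIV_const pow comp ray)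
  moreover have "(p / l * U (x + (l\<^sup>2 / l) *\<^sub>R \<theta>) + ?D * - 1 * (l / l) powr p) - ?D - c * (1 - 0)
      = 2 * (p / (2 * l) * U (x + l *\<^sub>R \<theta>) - ?D) - c"
    unfolding ll using l by (simp add: field_simps)
  ultimately have der: "(\<Phi> has_real_derivative 2 * (p / (2 * l) * U (x + l *\<^sub>R \<theta>) - ?D) - c) (at l)"
    by (simp only:)
  have "2 * (v - D) - c < 0" if "\<not> D < v" for v D :: real
    using c that by argo
  from has_real_derivative_neg_dec_right[OF der this[OF neg]]
  obtain d where d: "d > 0" "\<And>h. 0 < h \<Longrightarrow> h < d \<Longrightarrow> \<Phi> (l + h) < \<Phi> l"
    by auto
  define h where "h = min (d / 2) (l / 4)"
  have h: "0 < h" "h < d" "h < l / 2" using d(1) l by (auto simp: h_def)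
  have "\<Phi> l = 0" unfolding \<Phi>_def ll using l by simp
  then have "\<Phi> (l + h) < 0" using d(2)[of h] h by simp
  moreover have "c * (l + h - l) \<le> kelvin x l (x + (l + h) *\<^sub>R \<theta>) - U (x + (l + h) *\<^sub>R \<theta>)"
    using hopf[of "x + (l + h) *\<^sub>R \<theta>"] h l \<theta> by simp
  ultimately show False
    using h l \<theta> kelvin_ray[of "l + h" \<theta> x l] by (simp add: \<Phi>_def)
qed

text \<open>
  Near the centre a violation would, by \<open>ray_mvt\<close>, force a slope larger than \<open>p / (2 t)\<close> times \<open>U\<close>,
  which exceeds the Lipschitz constant of \<open>U\<close> once \<open>t\<close> is below some \<open>r0\<close>. At distance at least \<open>r0\<close> the
  potential grows like \<open>\<bar>z - x\<bar>\<^sup>p\<close> with a fixed constant, whereas the Kelvin transform has the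
  factor \<open>l\<^sup>-\<^sup>p\<close>, which is large for small \<open>l\<close>.
\<close>

lemma admissible_small:
  assumes x: "x \<noteq> 0"
  shows "\<exists>l. 0 < l \<and> l < norm x \<and> admissible x l"
proof -
  let ?K = "cball x (norm x / 2)"
  have K0: "?K \<subseteq> - {0}" using x by (auto simp: dist_norm)
  have "compact (U' ` ?K)"
    using U'_cont K0 by (intro compact_continuous_image) (auto intro: continuous_on_subset)
  then obtain L where L: "L > 0" "\<And>y. y \<in> ?K \<Longrightarrow> norm (U' y) \<le> L"
    using compact_imp_bounded[THEN bounded_pos[THEN iffD1]] by (metis imageI)
  have "continuous_on ?K U"
    using U_isCont continuous_at_imp_continuous_on by blast
  moreover have "?K \<noteq> {}" by simp
  ultimately obtain y0 where y0: "\<And>y. y \<in> ?K \<Longrightarrow> U y0 \<le> U y"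
    using continuous_attains_inf[OF compact_cball] by blast
  define m where "m = U y0"
  have m: "m > 0" "\<And>y. y \<in> ?K \<Longrightarrow> m \<le> U y" using U_pos y0 by (auto simp: m_def)
  define r0 where "r0 = min (norm x / 2) (p * m / (2 * (L + 1)))"
  have r0: "0 < r0" "r0 \<le> norm x / 2" "r0 \<le> p * m / (2 * (L + 1))"
    unfolding r0_def using x p_pos m(1) L(1) by (simp, intro min.cobounded1, intro min.cobounded2)
  have steep: "L < p / (2 * r0) * m"
    using r0(1,3) L(1) by (simp add: field_simps)
  define C where "C = (LINT y|lborel. 2 powr p * (r0 powr p + norm (x - y) powr p) * F y)"
  have Cint: "integrable lborel (\<lambda>y. 2 powr p * (r0 powr p + norm (x - y) powr p) * F y)"
  proof -
    have "integrable lborel (\<lambda>y. (2 powr p * r0 powr p) * F y + 2 powr p * (norm (x - y) powr p * F y))"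
      by (intro Bochner_Integration.integrable_add integrable_mult_right F_integrable kernel_integrable)
    then show ?thesis by (simp add: algebra_simps)
  qed
  have C: "C \<ge> 0" unfolding C_def using F_nonneg by (intro Bochner_Integration.integral_nonneg) auto
  have far: "U z \<le> (norm (z - x) / r0) powr p * C" if z: "r0 \<le> norm (z - x)" for z
  proof -
    let ?d = "norm (z - x)"
    have "U z \<le> (LINT y|lborel. (?d / r0) powr p * (2 powr p * (r0 powr p + norm (x - y) powr p) * F y))"
      unfolding U_def
    proof (rule integral_mono[OF kernel_integrable integrable_mult_right[OF Cint]])
      fix y
      have "norm (z - y) \<le> ?d + norm (x - y)"
        using norm_triangle_ineq[of "z - x" "x - y"] by simp
      also have "\<dots> \<le> ?d + ?d / r0 * norm (x - y)"
        using z r0(1) mult_right_mono[of 1 "?d / r0" "norm (x - y)"] by simp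
      also have "\<dots> = ?d / r0 * (r0 + norm (x - y))"
        using r0(1) by (simp add: field_simps)
      finally have "norm (z - y) powr p \<le> (?d / r0 * (r0 + norm (x - y))) powr p"
        using p_pos by (intro powr_mono2) auto
      also have "\<dots> = (?d / r0) powr p * (r0 + norm (x - y)) powr p"
        using r0(1) by (intro powr_mult)
      also have "\<dots> \<le> (?d / r0) powr p * (2 powr p * (r0 powr p + norm (x - y) powr p))"
        using r0(1) p_pos by (intro mult_left_mono powr_add_le) auto
      finally have "norm (z - y) powr p \<le> (?d / r0) powr p * (2 powr p * (r0 powr p + norm (x - y) powr p))" .
      from mult_right_mono[OF this F_nonneg[of y]]
      show "norm (z - y) powr p * F y \<le> (?d / r0) powr p * (2 powr p * (r0 powr p + norm (x - y) powr p) * F y)"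
        by (simp only: mult.assoc)
    qed
    then show ?thesis by (simp add: C_def)
  qed
  \<comment> \<open>With \<open>l = r0 q\<close> the Kelvin transform exceeds \<open>(\<bar>z - x\<bar> / r0)\<^sup>p m / q\<^sup>p = (\<bar>z - x\<bar> / r0)\<^sup>p (C + m)\<close>.\<close>
  define q where "q = (m / (C + m)) powr (1 / p)"
  define l where "l = r0 * q"
  have "m / (C + m) \<le> 1" using m(1) C by simp
  then have "q \<le> 1 powr (1 / p)" unfolding q_def using m(1) C p_pos by (intro powr_mono2) auto
  then have q: "0 < q" "q \<le> 1" using m(1) C by (auto simp: q_def)
  have qp: "q powr p = m / (C + m)" unfolding q_def using p_pos m(1) C by (simp add: powr_powr)
  have l: "0 < l" "l \<le> r0" using q r0(1) mult_left_mono[of q 1 r0] by (auto simp: l_def)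
  have near: "d < norm x" if "d \<le> r0" for d
    using that r0(1,2) by linarith
  have lx: "l < norm x" using near[OF l(2)] .
  have "admissible x l"
    unfolding admissible_def
  proof (intro allI impI)
    fix z assume z: "l < norm (z - x)"
    define \<theta> where "\<theta> = (1 / norm (z - x)) *\<^sub>R (z - x)"
    have \<theta>: "norm \<theta> = 1" "x + norm (z - x) *\<^sub>R \<theta> = z" using z l by (auto simp: \<theta>_def)
    show "U z \<le> kelvin x l z"
    proof (cases "norm (z - x) < r0")
      case True
      show ?thesis
      proof (rule ccontr)
        assume "\<not> ?thesis"
        then have "kelvin x l (x + norm (z - x) *\<^sub>R \<theta>) < U (x + norm (z - x) *\<^sub>R \<theta>)" by (simp add: \<theta>(2))
        then obtain t where t: "l\<^sup>2 / norm (z - x) < t" "t < norm (z - x)"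
          "p / (2 * t) * U (x + t *\<^sub>R \<theta>) < U' (x + t *\<^sub>R \<theta>) \<theta>"
          using ray_mvt[OF l(1) z near[OF less_imp_le[OF True]] \<theta>(1)] by blast
        have "0 < t" by (rule le_less_trans[OF _ t(1)]) simp
        then have t0: "0 < t" "t < r0" using t(2) True by linarith+
        have inK: "x + t *\<^sub>R \<theta> \<in> ?K" using t0 r0(2) \<theta>(1) by (simp add: dist_norm)
        have "p / (2 * r0) * m \<le> p / (2 * t) * U (x + t *\<^sub>R \<theta>)"
          using t0 p_pos m(1) m(2)[OF inK] by (intro mult_mono frac_le) auto
        moreover have "U' (x + t *\<^sub>R \<theta>) \<theta> \<le> L"
          using norm_blinfun[of "U' (x + t *\<^sub>R \<theta>)" \<theta>] L(2)[OF inK] \<theta>(1) by simp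
        ultimately show False using steep t(3) by linarith
      qed
    next
      case False
      let ?d = "norm (z - x)"
      have d: "r0 \<le> ?d" "0 < ?d" using False r0(1) by linarith+
      have "l\<^sup>2 / ?d \<le> l" using z l(1) d by (simp add: power2_eq_square divide_le_eq)
      then have "norm (sphere_inversion x l z - x) \<le> norm x / 2"
        unfolding norm_sphere_inversion using l r0(2) by linarith
      then have "sphere_inversion x l z \<in> ?K"
        by (simp add: dist_norm norm_minus_commute)
      then have "(?d / l) powr p * m \<le> kelvin x l z"
        unfolding kelvin_def using m(2) by (intro mult_left_mono) auto
      moreover have "(?d / l) powr p = (?d / r0) powr p / (q powr p)"
        unfolding l_def using r0(1) q(1) by (simp flip: powr_divide)
      then have "(?d / l) powr p * m = (?d / r0) powr p * (C + m)"
        using m(1) C by (simp add: qp)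
      moreover have "(?d / r0) powr p * C \<le> (?d / r0) powr p * (C + m)"
        using m(1) by (intro mult_left_mono) auto
      ultimately show ?thesis using far[OF d(1)] by linarith
    qed
  qed
  then show ?thesis using l lx by blast
qed

lemma inadmissible_open:
  assumes l: "0 < l" and bad: "\<not> admissible x l"
  shows "\<exists>e>0. \<forall>l'. \<bar>l' - l\<bar> < e \<longrightarrow> \<not> admissible x l'"
proof (rule ccontr)
  assume "\<not> ?thesis"
  then have "\<forall>e>0. \<exists>l'. \<bar>l' - l\<bar> < e \<and> admissible x l'" by auto
  then obtain s where s: "s \<longlonglongrightarrow> l" "\<And>k::nat. admissible x (s k)"
    by (rule obtain_approximating_sequence) blast
  have "U z \<le> kelvin x l z" if z: "l < norm (z - x)" for z
  proof (rule tendsto_lowerbound)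
    show "(\<lambda>k. kelvin x (s k) z) \<longlonglongrightarrow> kelvin x l z"
      using z l by (intro kelvin_tendsto s tendsto_const) auto
    show "\<forall>\<^sub>F k in sequentially. U z \<le> kelvin x (s k) z"
      using order_tendstoD(2)[OF s(1) z] s(2) by (auto elim!: eventually_mono simp: admissible_def)
  qed simp
  then show False using bad by (simp add: admissible_def)
qed

text \<open>
  If radii \<open>a k\<close> near \<open>l\<close> admit violating points \<open>b k\<close>, a subsequence of these either escapes to infinity or converges. Escape
  contradicts \<open>admissible_mass\<close>. A limit outside the sphere contradicts \<open>admissible_strict\<close>. A limit on the
  sphere turns, through the mean value points of \<open>ray_mvt\<close>, into a slope that contradicts \<open>boundary_slope\<close>.
\<close>

lemma admissible_open:
  assumes x: "x \<noteq> 0" and l: "0 < l" "l < norm x" and adm: "admissible x l"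
  shows "\<exists>e>0. \<forall>l'. \<bar>l' - l\<bar> < e \<longrightarrow> admissible x l'"
proof (rule ccontr)
  assume "\<not> ?thesis"
  then have "\<forall>e>0. \<exists>l'. \<bar>l' - l\<bar> < e \<and> \<not> admissible x l'" by auto
  then obtain s where s: "s \<longlonglongrightarrow> l" "\<And>k::nat. \<not> admissible x (s k)"
    by (rule obtain_approximating_sequence) blast
  then have "\<forall>k. \<exists>z. s k < norm (z - x) \<and> kelvin x (s k) z < U z"
    by (simp add: admissible_def not_le)
  then obtain z where z: "\<And>k. s k < norm (z k - x)" "\<And>k. kelvin x (s k) (z k) < U (z k)" by metis
  obtain r where r: "strict_mono r"
    "(\<exists>w. (z \<circ> r) \<longlonglongrightarrow> w) \<or> filterlim (\<lambda>k. norm (z (r k))) at_top sequentially"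
    by (rule subsequence_converges_or_escapes)
  define a where "a = s \<circ> r"
  define b where "b = z \<circ> r"
  have a: "a \<longlonglongrightarrow> l" unfolding a_def using LIMSEQ_subseq_LIMSEQ[OF s(1) r(1)] .
  have ab: "a k < norm (b k - x)" "kelvin x (a k) (b k) < U (b k)" for k
    using z by (auto simp: a_def b_def)
  have apos: "\<forall>\<^sub>F k in sequentially. 0 < a k" using order_tendstoD(1)[OF a l(1)] .
  from r(2) show False
  proof
    assume "filterlim (\<lambda>k. norm (z (r k))) at_top sequentially"
    then have inf: "filterlim (\<lambda>k. norm (b k)) at_top sequentially" by (simp add: b_def)
    have far: "filterlim (\<lambda>k. norm (b k - x)) at_top sequentially"
      using inf by (rule filterlim_norm_diff_at_top)
    have "(\<lambda>k. norm (sphere_inversion x (a k) (b k) - x)) \<longlonglongrightarrow> 0"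
      unfolding norm_sphere_inversion
      by (rule real_tendsto_divide_at_top[OF tendsto_power[OF a] far])
    then have "(\<lambda>k. sphere_inversion x (a k) (b k)) \<longlonglongrightarrow> x"
      by (simp add: tendsto_norm_zero_iff LIM_zero_iff)
    then have "(\<lambda>k. U (sphere_inversion x (a k) (b k)) / a k powr p) \<longlonglongrightarrow> U x / l powr p"
      using l by (intro tendsto_divide tendsto_powr U_tendsto a tendsto_const) auto
    moreover have "(\<lambda>k. U (b k) / norm (b k - x) powr p) \<longlonglongrightarrow> (LINT y|lborel. F y)"
      using U_growth[OF inf] .
    moreover have "\<forall>\<^sub>F k in sequentially. U (sphere_inversion x (a k) (b k)) / a k powr p \<le> U (b k) / norm (b k - x) powr p"
      using apos
    proof eventually_elim
      case (elim k)
      have d: "norm (b k - x) > 0" using ab(1)[of k] elim by linarith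
      have "U (sphere_inversion x (a k) (b k)) / a k powr p = kelvin x (a k) (b k) / norm (b k - x) powr p"
        using elim d by (simp add: kelvin_def powr_divide)
      then show ?case
        using ab(2)[of k] by (simp add: divide_right_mono)
    qed
    ultimately have "U x / l powr p \<le> (LINT y|lborel. F y)"
      by (intro tendsto_le[OF sequentially_bot]) auto
    then show False using admissible_mass[OF x l adm] by simp
  next
    assume "\<exists>w. (z \<circ> r) \<longlonglongrightarrow> w"
    then obtain w where w: "b \<longlonglongrightarrow> w" by (auto simp: b_def)
    define d where "d = (\<lambda>k. norm (b k - x))"
    have dlim: "d \<longlonglongrightarrow> norm (w - x)" unfolding d_def by (intro tendsto_intros w)
    have "l \<le> norm (w - x)"
      using LIMSEQ_le[OF a dlim] ab(1) by (auto simp: d_def less_imp_le)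
    moreover have wx: "w \<noteq> x" using calculation l by auto
    have "kelvin x l w \<le> U w"
      using LIMSEQ_le[OF kelvin_tendsto[OF a w wx l(1)] U_tendsto[OF w]] ab(2) by (auto intro: less_imp_le)
    then have "\<not> l < norm (w - x)" using admissible_strict[OF x l adm, of w] by auto
    ultimately have wl: "norm (w - x) = l" by simp
    define \<theta> where "\<theta> = (\<lambda>k. (1 / d k) *\<^sub>R (b k - x))"
    define \<theta>' where "\<theta>' = (1 / l) *\<^sub>R (w - x)"
    have \<theta>': "norm \<theta>' = 1" "x + l *\<^sub>R \<theta>' = w" using wl l by (auto simp: \<theta>'_def)
    have \<theta>lim: "\<theta> \<longlonglongrightarrow> \<theta>'"
      unfolding \<theta>_def \<theta>'_def using dlim w l wl by (intro tendsto_intros) auto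
    have dl: "d \<longlonglongrightarrow> l" using dlim wl by simp
    have "\<forall>\<^sub>F k in sequentially. \<exists>t. (a k)\<^sup>2 / d k < t \<and> t < d k \<and>
        p / (2 * t) * U (x + t *\<^sub>R \<theta> k) < U' (x + t *\<^sub>R \<theta> k) (\<theta> k)"
      using apos order_tendstoD(2)[OF dl l(2)]
    proof eventually_elim
      case (elim k)
      have dk: "a k < d k" "d k > 0" using ab(1)[of k] elim by (auto simp: d_def)
      then have \<theta>k: "norm (\<theta> k) = 1" "x + d k *\<^sub>R \<theta> k = b k" by (auto simp: \<theta>_def d_def)
      have "kelvin x (a k) (x + d k *\<^sub>R \<theta> k) < U (x + d k *\<^sub>R \<theta> k)" using ab(2)[of k] \<theta>k by simp
      then show ?case using ray_mvt[OF elim(1) dk(1) elim(2) \<theta>k(1)] by blast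
    qed
    then obtain t where t: "\<forall>\<^sub>F k in sequentially. (a k)\<^sup>2 / d k < t k \<and> t k < d k \<and>
        p / (2 * t k) * U (x + t k *\<^sub>R \<theta> k) < U' (x + t k *\<^sub>R \<theta> k) (\<theta> k)"
      unfolding eventually_ex by blast
    have "(\<lambda>k. (a k)\<^sup>2 / d k) \<longlonglongrightarrow> l\<^sup>2 / l" using l by (intro tendsto_intros a dl) auto
    then have lower: "(\<lambda>k. (a k)\<^sup>2 / d k) \<longlonglongrightarrow> l" using l by (simp add: power2_eq_square)
    have tl: "t \<longlonglongrightarrow> l"
      by (rule tendsto_sandwich[OF _ _ lower dl]) (use t in \<open>auto elim!: eventually_mono\<close>)
    have pt: "(\<lambda>k. x + t k *\<^sub>R \<theta> k) \<longlonglongrightarrow> w"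
      using tendsto_add[OF tendsto_const tendsto_scaleR[OF tl \<theta>lim], of x] \<theta>'(2) by simp
    have w0: "w \<noteq> 0" using ray_nonzero[OF \<theta>'(1), of l x] l \<theta>'(2) by auto
    have "isCont U' w"
      using U'_cont w0 continuous_on_eq_continuous_at[of "- {0}" U'] by auto
    then have "(\<lambda>k. U' (x + t k *\<^sub>R \<theta> k)) \<longlonglongrightarrow> U' w"
      using pt isCont_tendsto_compose by blast
    then have 1: "(\<lambda>k. U' (x + t k *\<^sub>R \<theta> k) (\<theta> k)) \<longlonglongrightarrow> U' w \<theta>'"
      using \<theta>lim by (intro blinfun.tendsto)
    have 2: "(\<lambda>k. p / (2 * t k) * U (x + t k *\<^sub>R \<theta> k)) \<longlonglongrightarrow> p / (2 * l) * U w"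
      using l by (intro tendsto_intros tl U_tendsto[OF pt]) auto
    have "p / (2 * l) * U w \<le> U' w \<theta>'"
      by (rule tendsto_le[OF sequentially_bot 1 2]) (use t in \<open>auto elim!: eventually_mono\<close>)
    then show False
      using boundary_slope[OF x l adm \<theta>'(1)] \<theta>'(2) by simp
  qed
qed

lemma admissible_all:
  assumes x: "x \<noteq> 0" and l: "0 < l" "l < norm x"
  shows "admissible x l"
proof -
  let ?A = "{l. 0 < l \<and> l < norm x \<and> admissible x l}" and ?B = "{l. 0 < l \<and> l < norm x \<and> \<not> admissible x l}"
  have op: "open {l. 0 < l \<and> l < norm x \<and> P l}"
    if P: "\<And>l. 0 < l \<Longrightarrow> l < norm x \<Longrightarrow> P l \<Longrightarrow> \<exists>e>0. \<forall>l'. \<bar>l' - l\<bar> < e \<longrightarrow> P l'" for P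
    unfolding open_dist
  proof
    fix l assume "l \<in> {l. 0 < l \<and> l < norm x \<and> P l}"
    then have l: "0 < l" "l < norm x" "P l" by auto
    obtain e where e: "e > 0" "\<And>l'. \<bar>l' - l\<bar> < e \<Longrightarrow> P l'" using P[OF l] by auto
    show "\<exists>e>0. \<forall>y. dist y l < e \<longrightarrow> y \<in> {l. 0 < l \<and> l < norm x \<and> P l}"
      using e l by (intro exI[of _ "min e (min l (norm x - l))"]) (auto simp: dist_real_def)
  qed
  have "open ?A" by (rule op) (use admissible_open x in blast)
  moreover have "open ?B" by (rule op) (use inadmissible_open in blast)
  moreover have "?A \<inter> ?B \<inter> {0<..<norm x} = {}" "{0<..<norm x} \<subseteq> ?A \<union> ?B" by auto
  ultimately have "?A \<inter> {0<..<norm x} = {} \<or> ?B \<inter> {0<..<norm x} = {}"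
    by (intro connectedD[of "{0<..<norm x}"]) (auto simp: connected_Ioo)
  then show ?thesis using admissible_small[OF x] l by auto
qed

section \<open>Monotonicity and symmetry\<close>

text \<open>
  The centre \<open>x\<close> lies on the ray from \<open>y\<close> through \<open>y'\<close>, at distance \<open>\<tau>\<close> beyond \<open>y'\<close>. With \<open>d = \<bar>y' - y\<bar>\<close> the radius
  \<open>l\<^sup>2 = (d + \<tau>) \<tau>\<close> makes \<open>y'\<close> the inverse of \<open>y\<close>, and \<open>\<bar>x\<bar>\<^sup>2 - l\<^sup>2 = \<bar>y'\<bar>\<^sup>2 + \<tau> (\<bar>y'\<bar>\<^sup>2 - \<bar>y\<bar>\<^sup>2) / d\<close> is positive.
  The Kelvin factor \<open>(1 + d / \<tau>)\<^sup>p\<^sup>/\<^sup>2\<close> tends to one as \<open>\<tau>\<close> grows.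
\<close>

lemma U_mono_strict:
  assumes yy: "norm y < norm y'"
  shows "U y \<le> U y'"
proof -
  define d where "d = norm (y' - y)"
  define e where "e = (1 / d) *\<^sub>R (y' - y)"
  have d: "d > 0" using yy by (auto simp: d_def)
  have e: "norm e = 1" "y' = y + d *\<^sub>R e" using d by (auto simp: e_def d_def)
  have le: "U y \<le> (1 + d / \<tau>) powr (p / 2) * U y'" if \<tau>: "\<tau> > 0" for \<tau>
  proof -
    define x where "x = y' + \<tau> *\<^sub>R e"
    define l where "l = sqrt ((d + \<tau>) * \<tau>)"
    have l2: "l\<^sup>2 = (d + \<tau>) * \<tau>"
      unfolding l_def using \<tau> d by (intro real_sqrt_pow2) simp
    have l: "l > 0" using \<tau> d by (simp add: l_def)
    have yx: "y - x = - ((d + \<tau>) *\<^sub>R e)" by (simp add: x_def e(2) algebra_simps)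
    then have nyx: "norm (y - x) = d + \<tau>" using e(1) d \<tau> by simp
    have ee: "e \<bullet> e = 1" using e(1) by (simp add: norm_eq_1)
    have "(norm y')\<^sup>2 - (norm y)\<^sup>2 = d * (2 * (y' \<bullet> e) - d)"
      unfolding power2_norm_eq_inner e(2)
      by (simp add: inner_add inner_commute ee algebra_simps)
    moreover have "(norm y')\<^sup>2 - (norm y)\<^sup>2 > 0" using yy by (simp add: power_strict_mono)
    ultimately have pos: "2 * (y' \<bullet> e) - d > 0" using d by (simp add: zero_less_mult_iff)
    have "(norm x)\<^sup>2 = (norm y')\<^sup>2 + \<tau> * (2 * (y' \<bullet> e)) + \<tau>\<^sup>2"
      unfolding power2_norm_eq_inner x_def
      by (simp add: inner_add inner_commute ee algebra_simps power2_eq_square)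
    also have "\<dots> \<ge> \<tau> * (2 * (y' \<bullet> e)) + \<tau>\<^sup>2" by simp
    also have "\<tau> * (2 * (y' \<bullet> e)) + \<tau>\<^sup>2 = l\<^sup>2 + \<tau> * (2 * (y' \<bullet> e) - d)"
      unfolding l2 by (simp add: algebra_simps power2_eq_square)
    finally have "l\<^sup>2 < (norm x)\<^sup>2" using mult_pos_pos[OF \<tau> pos] by linarith
    then have lx: "l < norm x" by (rule power2_less_imp_less) simp
    then have x0: "x \<noteq> 0" using l by auto
    have "l\<^sup>2 < (d + \<tau>)\<^sup>2" unfolding l2 using d \<tau> by (simp add: power2_eq_square)
    then have "l < norm (y - x)" unfolding nyx by (rule power2_less_imp_less) (use d \<tau> in simp)
    then have "U y \<le> kelvin x l y"
      using admissible_all[OF x0 l lx] by (simp add: admissible_def)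
    moreover have "sphere_inversion x l y = y'"
    proof -
      have "sphere_inversion x l y = x + (l\<^sup>2 / (d + \<tau>)\<^sup>2) *\<^sub>R (y - x)"
        by (simp only: sphere_inversion_def nyx)
      also have "\<dots> = x - (l\<^sup>2 / (d + \<tau>)\<^sup>2 * (d + \<tau>)) *\<^sub>R e"
        unfolding yx by simp
      also have "l\<^sup>2 / (d + \<tau>)\<^sup>2 * (d + \<tau>) = \<tau>"
        unfolding l2 using d \<tau> by (simp add: power2_eq_square)
      finally have "sphere_inversion x l y = x - \<tau> *\<^sub>R e" .
      then show ?thesis by (simp add: x_def)
    qed
    moreover have "((d + \<tau>) / l) powr p = (1 + d / \<tau>) powr (p / 2)"
    proof -
      have "((d + \<tau>) / l)\<^sup>2 = (d + \<tau>) / \<tau>"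
        unfolding power_divide l2 using d \<tau> by (simp add: power2_eq_square)
      also have "\<dots> = 1 + d / \<tau>" using \<tau> by (simp add: field_simps)
      finally have "(1 + d / \<tau>) powr (p / 2) = (((d + \<tau>) / l) powr 2) powr (p / 2)"
        using d \<tau> l by (simp add: powr_numeral)
      then show ?thesis by (simp add: powr_powr)
    qed
    ultimately show ?thesis by (simp add: kelvin_def nyx)
  qed
  have "(\<lambda>k. d / real (Suc k)) \<longlonglongrightarrow> 0"
    using LIMSEQ_Suc[OF lim_const_over_n[of d]] by simp
  then have "(\<lambda>k. (1 + d / real (Suc k)) powr (p / 2) * U y') \<longlonglongrightarrow> (1 + 0) powr (p / 2) * U y'"
    by (intro tendsto_intros) auto
  then show ?thesis
    using LIMSEQ_le_const[of _ "(1 + 0) powr (p / 2) * U y'" "U y"] le by simp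
qed

lemma U_mono:
  assumes "norm y \<le> norm y'" "y' \<noteq> 0"
  shows "U y \<le> U y'"
proof -
  have "(\<lambda>k. (1 + 1 / real (Suc k)) *\<^sub>R y') \<longlonglongrightarrow> (1 + 0) *\<^sub>R y'"
    using LIMSEQ_Suc[OF lim_1_over_n] by (intro tendsto_intros) simp
  then have "(\<lambda>k. U ((1 + 1 / real (Suc k)) *\<^sub>R y')) \<longlonglongrightarrow> U y'"
    using U_tendsto by force
  moreover have "U y \<le> U ((1 + 1 / real (Suc k)) *\<^sub>R y')" for k
  proof (rule U_mono_strict)
    have "norm y' < (1 + 1 / real (Suc k)) * norm y'" using assms(2) by simp
    then show "norm y < norm ((1 + 1 / real (Suc k)) *\<^sub>R y')" using assms(1) by (simp add: abs_of_pos add_pos_pos)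
  qed
  ultimately show ?thesis by (intro LIMSEQ_le_const) auto
qed

end

theorem theorem1p1:
  fixes p :: real
    and f :: "real \<Rightarrow> real \<Rightarrow> real"
    and u :: "real ^ 'n \<Rightarrow> real"
  assumes dim: "CARD('n) \<ge> 2"
    and p_pos: "p > 0"
    and f_pos: "\<And>s t. s > 0 \<Longrightarrow> t > 0 \<Longrightarrow> f s t > 0"
    and f_cont: "continuous_on ({0<..} \<times> {0<..}) (\<lambda>(s, t). f s t)"
    and f_cond: "\<And>(x :: real ^ 'n) lam (z :: real ^ 'n) a b.
        \<lbrakk>x \<noteq> 0; 0 < lam; lam < norm x; z \<noteq> 0; norm (z - x) > lam; 0 < a; a \<le> b\<rbrakk> \<Longrightarrow>
        f (norm z) a
          > (lam / norm (z - x)) powr (p + 2 * real CARD('n)) *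
            f (norm (x + (lam\<^sup>2 / (norm (z - x))\<^sup>2) *\<^sub>R (z - x)))
              ((lam / norm (z - x)) powr p * b)"
    and u_pos: "\<And>x. x \<noteq> 0 \<Longrightarrow> u x > 0"
    and u_C1: "C1_on u (- {0})"
    and u_eq: "\<And>x. x \<noteq> 0 \<Longrightarrow>
        has_bochner_integral lborel (\<lambda>y. norm (x - y) powr p * f (norm y) (u y)) (u x)"
  shows "\<exists>g :: real \<Rightarrow> real. (\<forall>r>0. g r > 0) \<and> mono_on {0<..} g \<and>
           (\<forall>x. x \<noteq> 0 \<longrightarrow> u x = g (norm x))"
proof -
  \<comment> \<open>The value zero at the origin makes F nonnegative everywhere; it changes no integral.\<close>
  define F where "F = (\<lambda>y. if y = 0 then 0 else f (norm y) (u y))"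
  have F_pos: "F y > 0" if "y \<noteq> 0" for y using that f_pos u_pos by (simp add: F_def)
  have F_nonneg: "F y \<ge> 0" for y using F_pos[of y] by (cases "y = 0") (auto simp: F_def)
  obtain e :: "real ^ 'n" where e: "norm e = 1" using vector_choose_size[of 1] by auto
  then have e0: "e \<noteq> 0" "- e \<noteq> 0" by auto
  have F_measurable [measurable]: "F \<in> borel_measurable borel"
  proof -
    have [measurable]: "(\<lambda>y. norm (e - y) powr p * f (norm y) (u y)) \<in> borel_measurable borel"
      using has_bochner_integral_iff[THEN iffD1, OF u_eq[OF e0(1)]] by auto
    have "F = (\<lambda>y. if y = 0 then 0 else if y = e then F e
        else norm (e - y) powr p * f (norm y) (u y) / norm (e - y) powr p)"
      by (auto simp: F_def fun_eq_iff)
    also have "\<dots> \<in> borel_measurable borel" by measurable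
    finally show ?thesis .
  qed
  have F_eq: "has_bochner_integral lborel (\<lambda>y. norm (x - y) powr p * F y) (u x)" if x: "x \<noteq> 0" for x
  proof (rule has_bochner_integral_cong_AE[THEN iffD1, OF _ _ _ u_eq[OF x]])
    show "AE y in lborel. norm (x - y) powr p * f (norm y) (u y) = norm (x - y) powr p * F y"
      using AE_lborel_singleton[of 0] by eventually_elim (simp add: F_def)
  qed (use has_bochner_integral_iff[THEN iffD1, OF u_eq[OF x]] in auto)
  \<comment> \<open>One of the two distances from \<open>y\<close> to the antipodal points \<open>e\<close> and \<open>- e\<close> is at least one, and one is at least \<open>\<bar>y\<bar>\<close>.\<close>
  define M where "M = (\<lambda>y. norm (e - y) powr p * F y + norm (- e - y) powr p * F y)"
  have M: "integrable lborel M"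
    unfolding M_def using F_eq[OF e0(1)] F_eq[OF e0(2)]
    by (intro Bochner_Integration.integrable_add) (auto simp: has_bochner_integral_iff)
  have M_ge: "a powr p * F y \<le> M y" if "0 \<le> a" "2 * a \<le> norm (e - y) + norm (- e - y)" for a y
  proof -
    have "a powr p \<le> (max (norm (e - y)) (norm (- e - y))) powr p"
      using that p_pos by (intro powr_mono2) auto
    also have "\<dots> \<le> norm (e - y) powr p + norm (- e - y) powr p" by (auto simp: max_def)
    finally show ?thesis
      using mult_right_mono[OF _ F_nonneg] by (auto simp: M_def simp flip: distrib_right)
  qed
  have "1 powr p * F y \<le> M y" for y
  proof (rule M_ge)
    have "(e - y) - (- e - y) = 2 *\<^sub>R e" by (simp add: vec_eq_iff)
    then show "2 * 1 \<le> norm (e - y) + norm (- e - y)"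
      using norm_triangle_ineq4[of "e - y" "- e - y"] e by simp
  qed simp
  then have F_int: "integrable lborel F"
    using F_nonneg by (intro Bochner_Integration.integrable_bound[OF M]) (auto intro!: AE_I2 intro: order_trans[OF _ abs_ge_self])
  have "norm y powr p * F y \<le> M y" for y
  proof (rule M_ge)
    have "(e - y) + (- e - y) = (- 2) *\<^sub>R y" by (simp add: vec_eq_iff)
    then show "2 * norm y \<le> norm (e - y) + norm (- e - y)"
      using norm_triangle_ineq[of "e - y" "- e - y"] by simp
  qed simp
  then have F_mom: "integrable lborel (\<lambda>y. norm y powr p * F y)"
    using F_nonneg by (intro Bochner_Integration.integrable_bound[OF M]) (auto intro!: AE_I2 intro: order_trans[OF _ abs_ge_self] simp: abs_mult)
  interpret potential_density p F
    by standard (use p_pos F_nonneg F_pos F_int F_mom in auto)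
  have Uu: "U x = u x" if "x \<noteq> 0" for x
    using F_eq[OF that] by (simp add: U_def has_bochner_integral_iff)
  obtain u' :: "real ^ 'n \<Rightarrow> ((real ^ 'n) \<Rightarrow>\<^sub>L real)"
    where u': "\<And>x. x \<noteq> 0 \<Longrightarrow> (u has_derivative blinfun_apply (u' x)) (at x)" "continuous_on (- {0}) u'"
    using u_C1 by (auto simp: C1_on_def)
  interpret moving_spheres p F u'
  proof
    fix y :: "real ^ 'n" assume y: "y \<noteq> 0"
    show "(U has_derivative blinfun_apply (u' y)) (at y)"
      by (rule has_derivative_transform_within_open[OF u'(1)[OF y], of "- {0}"]) (use y Uu in auto)
  next
    show "continuous_on (- {0}) u'" by (rule u'(2))
  next
    fix x z :: "real ^ 'n" and l
    assume *: "x \<noteq> 0" "0 < l" "l < norm x" "l < norm (z - x)" "z \<noteq> 0" "U z \<le> kelvin x l z"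
    let ?y = "sphere_inversion x l z"
    have d: "0 < norm (z - x)" using * by linarith
    have "norm (?y - x) < l"
      using * d by (simp add: norm_sphere_inversion power2_eq_square divide_less_eq)
    then have y0: "?y \<noteq> 0" using *(3) by (auto simp: norm_minus_commute)
    have "(l / norm (z - x)) powr p * kelvin x l z = u ?y"
      using * d Uu[OF y0] by (simp add: kelvin_def powr_divide)
    then have "(l / norm (z - x)) powr (p + 2 * real CARD('n)) * f (norm ?y) (u ?y) < f (norm z) (u z)"
      using f_cond[OF *(1,2,3,5,4) u_pos[OF *(5)], of "kelvin x l z"] *(5,6) Uu
      by (simp add: sphere_inversion_def)
    moreover have "F z = f (norm z) (u z)" "F ?y = f (norm ?y) (u ?y)"
      using *(5) y0 by (simp_all add: F_def)
    ultimately show "0 < gain x l z" by (simp add: gain_def)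
  qed
  have mono: "u y \<le> u y'" if "norm y \<le> norm y'" "y \<noteq> 0" "y' \<noteq> 0" for y y'
    using U_mono[OF that(1,3)] Uu that by simp
  show ?thesis
  proof (intro exI[of _ "\<lambda>r. u (r *\<^sub>R e)"] conjI allI impI)
    show "u (r *\<^sub>R e) > 0" if "r > 0" for r using that e0 u_pos by simp
    show "mono_on {0<..} (\<lambda>r. u (r *\<^sub>R e))"
      by (rule mono_onI) (use e e0 in \<open>auto intro!: mono\<close>)
    show "u x = u (norm x *\<^sub>R e)" if "x \<noteq> 0" for x
      using that e e0 by (intro antisym mono) auto
  qed
qed

end
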